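(* Let $u$ be an odd prime and let $(x,y,z,n)$ be an exceptional solution of $[(u^2-4)n]^x+(4un)^y=[(u^2+4)n]^z$, with associated decomposition $u^2-4=u_1u_2$ (as defined in the context). Then one of the following holds: (1) $\nu_2(u_1-1)=3$; $x$ is odd, $\nu_2(y)\ge 2$, $\nu_2(z)=1$; and $u_1=t_1t_2$ for coprime integers $t_1,t_2>1$ with $t_1\equiv t_2\equiv 5\pmod 8$ satisfying $t_2^x+t_1^x=2(u^2+4)^{z/2}$ and $t_2^x-t_1^x=2^{y+1}u^{y/2}n^{(y-z)/2}$. (2) $u_1\equiv 5\pmod 8$ and $u_2=w^{2^s}$ for a positive integer $w$, where $s=\nu_2(z-x)-\nu_2(x)$, and one of the following holds: (2.1) $w\equiv \pm 3\pmod 8$; $x$ and $z$ are odd and $\nu_2(y)\ge 1$; $u\equiv 1\pmod 4$; $\left(\frac{u_1}{p}\right)=\left(\frac{w}{p}\right)$ for every prime $p\mid u^2+4$, and $\left(\frac{w}{p}\right)=\left(\frac{u^2+4}{p}\right)$ for every prime $p\mid u_1$; (2.2) $w\equiv \pm 1\pmod 8$; $\nu_2(x)=\nu_2(z)=\beta$ for some $\beta\ge 1$ and $y$ is odd; $u\equiv \pm 3\pmod 8$; $\left(\frac{w}{p}\right)=1$ for every prime $p\mid u^2+4$, and $\left(\frac{w}{p}\right)=\left(\frac{u}{p}\right)$ for every prime $p\mid u_1$; moreover, if $u\equiv 3\pmod 8$, then $w$ is not a perfect square.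
   Context: Let $u$ be an odd prime. Consider the equation $[(u^2-4)n]^x+(4un)^y=[(u^2+4)n]^z$ in positive integers $x,y,z,n$. A solution is exceptional if $n>1$ and $(x,y,z)\neq(2,2,2)$. It is known that every exceptional solution satisfies $y>z>x$; moreover $\gcd(n,u^2+4)=1$ and there are unique coprime positive integers $u_1,u_2$ with $u_1u_2=u^2-4$, $(u^2+4)^z-(4u)^yn^{y-z}=u_1^x$ and $n^{z-x}=u_2^x$ (the associated decomposition). $\nu_2(t)$ denotes the exponent of $2$ in $t$; $\left(\frac{\cdot}{p}\right)$ is the Legendre symbol. *)

theory Defs
  imports
    "HOL-Number_Theory.Number_Theory"
    "HOL-Computational_Algebra.Nth_Powers"
begin

definition is_solution :: "int \<Rightarrow> nat \<Rightarrow> nat \<Rightarrow> nat \<Rightarrow> int \<Rightarrow> bool" where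
  "is_solution u x y z n \<longleftrightarrow>
     x > 0 \<and> y > 0 \<and> z > 0 \<and> n > 0 \<and>
     ((u\<^sup>2 - 4) * n) ^ x + (4 * u * n) ^ y = ((u\<^sup>2 + 4) * n) ^ z"

definition exceptional :: "int \<Rightarrow> nat \<Rightarrow> nat \<Rightarrow> nat \<Rightarrow> int \<Rightarrow> bool" where
  "exceptional u x y z n \<longleftrightarrow>
     is_solution u x y z n \<and> n > 1 \<and> (x, y, z) \<noteq> (2, 2, 2)"

(* The exponents y - z and z - x are natural-number differences. They agree with the
   integer differences for every exceptional solution, since then y > z > x. *)
definition associated_decomposition ::
    "int \<Rightarrow> nat \<Rightarrow> nat \<Rightarrow> nat \<Rightarrow> int \<Rightarrow> int \<Rightarrow> int \<Rightarrow> bool" where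
  "associated_decomposition u x y z n u1 u2 \<longleftrightarrow>
     u1 > 0 \<and> u2 > 0 \<and> coprime u1 u2 \<and> u1 * u2 = u\<^sup>2 - 4 \<and>
     (u\<^sup>2 + 4) ^ z - (4 * u) ^ y * n ^ (y - z) = u1 ^ x \<and>
     n ^ (z - x) = u2 ^ x"

end

(*
  Write c = u^2 + 4. Modulo a prime p dividing c we have 4u = (u + 2)^2 and u^2 - 4 = -8, while
  (2/c) = -1 because c = 5 (mod 8). Taking Legendre symbols in u1^x + (4u)^y n^(y-z) = c^z and
  n^(z-x) = u2^x at the primes dividing c and u1, and comparing the results by quadratic
  reciprocity for the Jacobi symbol, fixes the parities of x, y, z and the residues modulo 8. If z
  is even, a difference of two 2^j-th powers equals u1^x, so its factors are x-th powers
  themselves, and the same symbols apply to their bases.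

  Symbols do not exclude x odd with z (and then y) divisible by 4. There the 2-adic valuation
  forces u to be exponentially large in the exponents, so that truncated expansions in powers of u
  of the quantities involved become exact and contradict their size or parity.
*)
theory Submission
  imports Defs
begin

section \<open>The Jacobi symbol\<close>

text \<open>The statement asks for symbols at single primes, while residues modulo 8 come only out
  of a whole Jacobi symbol. The passage between the two is that a positive divisor t of u^2 - 4 has
  c = 8 (mod t), and c = 1 (mod 4), whence (t/c) = (c/t) = (8/t) = (2/t). When x and z are even,
  this does not reach u modulo 8. The additional quantity is h = (A + B)/2, where c^z = A^(2^k),
  u1^x = B^(2^k) and 2^k is the exact power of 2 in both x and z. It is 5 modulo 8 and coprime to
  its cofactor in A^(2^k) - B^(2^k) = (4u)^y n^(y-z); so, apart from a possible u^y, all of h lies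
  in n^(y-z), and its symbols against u1 tie u to h modulo 8. In the size argument n is known only
  through n^(z-x) = u2^x; hence two regimes, according to which of n^(y/4 - z/4) and n^(z-x) is the
  larger.\<close>

lemma Legendre_cong: "[a = b] (mod p) \<Longrightarrow> Legendre a p = Legendre b p"
  by (simp add: Legendre_def QuadRes_def cong_def)

lemma Legendre_values: "Legendre a p \<in> {-1, 0, 1}"
  by (auto simp: Legendre_def)

lemma Legendre_pm1: "\<not> p dvd a \<Longrightarrow> Legendre a p = 1 \<or> Legendre a p = -1"
  by (auto simp: Legendre_def cong_0_iff)

lemma odd_prime_int_gt_2: "prime p \<Longrightarrow> odd p \<Longrightarrow> 2 < (p::int)"
  using prime_gt_1_int[of p] by (cases "p = 2") auto

lemma euler_criterion_int:
  assumes "prime p" "odd (p::int)"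
  shows "[Legendre a p = a ^ nat ((p - 1) div 2)] (mod p)"
proof -
  have "2 < p" using assms odd_prime_int_gt_2 by blast
  then have "prime (nat p)" "2 < nat p" "int (nat p) = p"
    using assms by auto
  moreover have "(nat p - 1) div 2 = nat ((p - 1) div 2)" using \<open>2 < p\<close> by linarith
  ultimately show ?thesis using euler_criterion[of "nat p" a] by simp
qed

text \<open>Euler's criterion yields congruences only. Values from {-1, 0, 1} differ by at most 2,
  so for p > 2 a congruence between them is an equality.\<close>

lemma small_cong_imp_eq:
  fixes p x y :: int
  assumes "[x = y] (mod p)" "2 < p" "x \<in> {-1,0,1}" "y \<in> {-1,0,1}"
  shows "x = y"
proof -
  have "p dvd x - y" using assms(1) by (simp add: cong_iff_dvd_diff)
  moreover have "\<bar>x - y\<bar> < p" using assms by auto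
  ultimately show ?thesis using zdvd_not_zless[of "\<bar>x - y\<bar>" p] by fastforce
qed

lemma Legendre_mult:
  assumes "prime p" "odd (p::int)"
  shows "Legendre (a * b) p = Legendre a p * Legendre b p"
proof (rule small_cong_imp_eq[of _ _ p])
  let ?k = "nat ((p - 1) div 2)"
  have "[Legendre (a * b) p = (a * b) ^ ?k] (mod p)" by (rule euler_criterion_int[OF assms])
  moreover have "[Legendre a p * Legendre b p = a ^ ?k * b ^ ?k] (mod p)"
    by (intro cong_mult euler_criterion_int assms)
  ultimately show "[Legendre (a * b) p = Legendre a p * Legendre b p] (mod p)"
    unfolding power_mult_distrib using cong_trans cong_sym by blast
  show "2 < p" using assms odd_prime_int_gt_2 by blast
qed (use Legendre_values[of a p] Legendre_values[of b p] Legendre_values[of "a*b" p] in auto)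

lemma Legendre_1: "prime p \<Longrightarrow> Legendre 1 (p::int) = 1"
  by (auto simp: Legendre_def QuadRes_def cong_0_iff intro!: exI[of _ 1])

lemma Legendre_power:
  assumes "prime p" "odd (p::int)"
  shows "Legendre (a ^ k) p = Legendre a p ^ k"
  by (induction k) (simp_all add: Legendre_1 Legendre_mult assms)

lemma Legendre_square: "\<not> p dvd a \<Longrightarrow> Legendre (a ^ 2) (p::int) = 1" if "prime p"
  using that by (auto simp: Legendre_def QuadRes_def cong_0_iff prime_dvd_power_iff
    intro!: exI[of _ a])

lemma Legendre_power_odd:
  assumes "prime p" "odd (p::int)" "odd k"
  shows "Legendre (a ^ k) p = Legendre a p"
  using Legendre_values[of a p] assms by (auto simp: Legendre_power power_0_left odd_pos)

lemma Legendre_power_even: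
  assumes "prime p" "odd (p::int)" "even k" "\<not> p dvd a"
  shows "Legendre (a ^ k) p = 1"
  using Legendre_pm1[OF assms(4)] assms by (auto simp: Legendre_power)

lemma Legendre_minus_1:
  assumes "prime p" "odd (p::int)"
  shows "Legendre (-1) p = (if p mod 4 = 1 then 1 else -1)"
proof (rule small_cong_imp_eq[of _ _ p])
  have *: "2 < p" using assms odd_prime_int_gt_2 by blast
  have "(-1) ^ nat ((p - 1) div 2) = (if p mod 4 = 1 then 1 else (-1::int))"
  proof (cases "p mod 4 = 1")
    case True
    then have "even ((p - 1) div 2)" by presburger
    then have "even (nat ((p - 1) div 2))" using * by (simp add: even_nat_iff)
    then show ?thesis using True by simp
  next
    case False
    then have "odd ((p - 1) div 2)" using assms(2) by presburger
    then have "odd (nat ((p - 1) div 2))" using * by (simp add: even_nat_iff)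
    then show ?thesis using False by simp
  qed
  then show "[Legendre (-1) p = (if p mod 4 = 1 then 1 else -1)] (mod p)"
    using euler_criterion_int[OF assms, of "-1"] by simp
  show "2 < p" by fact
qed (use Legendre_values[of "-1" p] in auto)

text \<open>The multiset of prime factors counts multiplicities. It is empty for
  \<open>n = 0\<close>, which is why multiplicativity in the lower argument asks for nonzero
  factors.\<close>

definition jacobi :: "int \<Rightarrow> int \<Rightarrow> int" where
  "jacobi a n = (\<Prod>p\<in>#prime_factorization n. Legendre a p)"

lemma jacobi_1_right [simp]: "jacobi a 1 = 1"
  by (simp add: jacobi_def)

lemma jacobi_prime: "prime p \<Longrightarrow> jacobi a p = Legendre a p"
  by (simp add: jacobi_def prime_factorization_prime)

lemma jacobi_mult_right: "m \<noteq> 0 \<Longrightarrow> n \<noteq> 0 \<Longrightarrow> jacobi a (m * n) = jacobi a m * jacobi a n"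
  by (simp add: jacobi_def prime_factorization_mult)

text \<open>Passage from single primes to the whole modulus: symbols compared at each prime divisor
  of \<open>n\<close> are multiplied up here.\<close>

lemma jacobi_transfer:
  assumes "\<And>p. prime p \<Longrightarrow> p dvd n \<Longrightarrow> Legendre a p = Legendre b p"
  shows "jacobi a n = jacobi b n"
  unfolding jacobi_def
  by (intro arg_cong[where f = prod_mset] image_mset_cong assms) 
    (auto simp: in_prime_factors_iff)

lemma jacobi_cong: "[a = b] (mod n) \<Longrightarrow> jacobi a n = jacobi b n"
  by (intro jacobi_transfer Legendre_cong) (meson cong_dvd_modulus)

lemma jacobi_eq_1:
  assumes "\<And>p. prime p \<Longrightarrow> p dvd n \<Longrightarrow> Legendre a p = 1"
  shows "jacobi a n = 1"
proof -
  have "jacobi a n = (\<Prod>p\<in>#prime_factorization n. 1)"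
    unfolding jacobi_def
    by (intro arg_cong[where f = prod_mset] image_mset_cong assms) 
      (auto simp: in_prime_factors_iff)
  then show ?thesis by simp
qed

lemma jacobi_mult_left:
  assumes "odd n"
  shows "jacobi (a * b) n = jacobi a n * jacobi b n"
proof -
  have "jacobi (a * b) n = (\<Prod>p\<in>#prime_factorization n. Legendre a p * Legendre b p)"
    unfolding jacobi_def
  proof (intro arg_cong[where f = prod_mset] image_mset_cong)
    fix p assume "p \<in># prime_factorization n"
    then have "prime p" "p dvd n" by (auto simp: in_prime_factors_iff)
    moreover have "odd p" using \<open>p dvd n\<close> assms by (metis dvd_trans)
    ultimately show "Legendre (a * b) p = Legendre a p * Legendre b p"
      by (simp add: Legendre_mult)
  qed
  then show ?thesis by (simp add: jacobi_def prod_mset.distrib)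
qed

lemma jacobi_1_left [simp]: "jacobi 1 n = 1"
  by (intro jacobi_eq_1 Legendre_1)

lemma jacobi_power_left: "odd n \<Longrightarrow> jacobi (a ^ k) n = jacobi a n ^ k"
  by (induction k) (simp_all add: jacobi_mult_left)

lemma prime_induct_pos_int [consumes 1, case_names one mult]:
  assumes "(n::int) > 0" "P 1"
    "\<And>p m. prime p \<Longrightarrow> m > 0 \<Longrightarrow> P m \<Longrightarrow> P (p * m)"
  shows "P n"
proof -
  have "n > 0 \<longrightarrow> P n"
  proof (induction n rule: prime_divisors_induct)
    case (unit x)
    then show ?case using assms(2) by auto
  next
    case (factor p x)
    then have "p > 0" using prime_gt_0_int by blast
    then show ?case using assms(3) factor by (simp add: zero_less_mult_iff)
  qed simp
  then show ?thesis using assms(1) by simp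
qed

lemma jacobi_pm1:
  assumes "n > 0" "coprime a n"
  shows "jacobi a n = 1 \<or> jacobi a n = -1"
  using assms
proof (induction n rule: prime_induct_pos_int)
  case (mult p m)
  then have "\<not> p dvd a"
    by (metis coprime_common_divisor coprime_mult_right_iff dvd_refl not_prime_unit)
  then have "Legendre a p = 1 \<or> Legendre a p = -1" by (rule Legendre_pm1)
  moreover have "jacobi a m = 1 \<or> jacobi a m = -1" using mult by simp
  moreover have "p \<noteq> 0" using mult by auto
  ultimately show ?case using mult by (auto simp: jacobi_mult_right jacobi_prime)
qed simp

lemma jacobi_minus_1:
  assumes "n > 0" "odd n"
  shows "jacobi (-1) n = (if n mod 4 = 1 then 1 else -1)"
  using assms
proof (induction n rule: prime_induct_pos_int)
  case (mult p m)
  then have "p \<noteq> 0" "odd p" "odd m" by auto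
  then have p: "p mod 4 = 1 \<or> p mod 4 = 3" and m: "m mod 4 = 1 \<or> m mod 4 = 3" by presburger+
  have "p * m mod 4 = ((p mod 4) * (m mod 4)) mod 4" by (simp add: mod_mult_eq)
  then have "p * m mod 4 = (if p mod 4 = m mod 4 then 1 else 3)"
    using p m by auto
  then show ?case using p m mult \<open>p \<noteq> 0\<close> \<open>odd p\<close> \<open>odd m\<close>
    by (auto simp: jacobi_mult_right jacobi_prime Legendre_minus_1)
qed simp

text \<open>The sign (-1)^((m-1)/2 * (n-1)/2) for odd \<open>m\<close> and \<open>n\<close>, encoded
  by residues modulo 4 so that its multiplicativity is a finite check.\<close>

definition recip_sign :: "int \<Rightarrow> int \<Rightarrow> int" where
  "recip_sign m n = (if m mod 4 = 3 \<and> n mod 4 = 3 then -1 else 1)"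

lemma recip_sign_mult:
  assumes "odd m" "odd n"
  shows "recip_sign k (m * n) = recip_sign k m * recip_sign k n"
proof -
  have m: "m mod 4 = 1 \<or> m mod 4 = 3" and n: "n mod 4 = 1 \<or> n mod 4 = 3" using assms by presburger+
  have "m * n mod 4 = ((m mod 4) * (n mod 4)) mod 4" by (simp add: mod_mult_eq)
  then have "m * n mod 4 = (if m mod 4 = n mod 4 then 1 else 3)"
    using m n by auto
  then show ?thesis using m n by (auto simp: recip_sign_def)
qed

lemma recip_sign_commute: "recip_sign m n = recip_sign n m"
  by (auto simp: recip_sign_def)

lemma Legendre_reciprocity:
  assumes "prime p" "odd p" "prime q" "odd q" "p \<noteq> q"
  shows "Legendre p q * Legendre q p = recip_sign p q"
proof -
  have pq: "2 < p" "2 < q" using assms odd_prime_int_gt_2 by blast+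
  have *: "Legendre p q * Legendre q p = (-1) ^ nat ((p - 1) div 2 * ((q - 1) div 2))"
    using Quadratic_Reciprocity_int[of "nat p" "nat q"] assms pq by (simp add: eq_nat_nat_iff)
  have "odd (nat ((p - 1) div 2 * ((q - 1) div 2))) \<longleftrightarrow> odd ((p - 1) div 2 * ((q - 1) div 2))"
    using pq by (simp add: even_nat_iff)
  also have "\<dots> \<longleftrightarrow> p mod 4 = 3 \<and> q mod 4 = 3"
    using assms(2,4) by (simp, presburger)
  finally show ?thesis unfolding * recip_sign_def by (auto simp: uminus_power_if)
qed

lemma jacobi_prime_reciprocity:
  assumes "n > 0" "prime p" "odd p" "odd n" "coprime p n"
  shows "jacobi p n * Legendre n p = recip_sign p n"
  using assms
proof (induction n rule: prime_induct_pos_int)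
  case one
  then show ?case by (simp add: Legendre_1 recip_sign_def)
next
  case (mult q m)
  have "p \<noteq> q" using mult by auto
  have "q \<noteq> 0" "odd q" "odd m" using mult by auto
  have "jacobi p (q * m) * Legendre (q * m) p
      = (Legendre p q * Legendre q p) * (jacobi p m * Legendre m p)"
    using mult \<open>q \<noteq> 0\<close> by (simp add: jacobi_mult_right jacobi_prime Legendre_mult)
  also have "\<dots> = recip_sign p q * recip_sign p m"
    using mult Legendre_reciprocity[of p q] \<open>p \<noteq> q\<close> \<open>odd q\<close> \<open>odd m\<close> by simp
  finally show ?case using recip_sign_mult[OF \<open>odd q\<close> \<open>odd m\<close>] by simp
qed

lemma jacobi_reciprocity_sign:
  assumes "m > 0" "n > 0" "odd m" "odd n" "coprime m n"
  shows "jacobi m n * jacobi n m = recip_sign m n"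
  using assms
proof (induction m rule: prime_induct_pos_int)
  case one
  then show ?case by (simp add: recip_sign_def)
next
  case (mult q m)
  have "q \<noteq> 0" "odd q" "odd m" using mult by auto
  have "jacobi (q * m) n * jacobi n (q * m)
      = (jacobi q n * Legendre n q) * (jacobi m n * jacobi n m)"
    using mult \<open>q \<noteq> 0\<close> by (simp add: jacobi_mult_right jacobi_prime jacobi_mult_left)
  also have "\<dots> = recip_sign q n * recip_sign m n"
    using mult jacobi_prime_reciprocity[of n q] \<open>odd q\<close> \<open>odd m\<close> by simp
  finally show ?case using recip_sign_mult[OF \<open>odd q\<close> \<open>odd m\<close>] 
    by (simp add: recip_sign_commute[of _ n])
qed

lemma jacobi_reciprocity:
  assumes "m > 0" "n > 0" "odd m" "odd n" "coprime m n" "m mod 4 = 1 \<or> n mod 4 = 1"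
  shows "jacobi m n = jacobi n m"
proof -
  have "jacobi m n * jacobi n m = 1"
    using jacobi_reciprocity_sign[OF assms(1-5)] assms(6) by (auto simp: recip_sign_def)
  then show ?thesis by (auto simp: zmult_eq_1_iff)
qed

text \<open>Reciprocity for the neighbouring odd numbers \<open>n\<close> and \<open>n - 2\<close> turns \<open>(2/n)\<close> into
  \<open>(-1/n) (2/(n-2))\<close>, so no count of residues is needed.\<close>

lemma jacobi_2:
  assumes "n > 0" "odd n"
  shows "jacobi 2 n = (if n mod 8 = 1 \<or> n mod 8 = 7 then 1 else -1)"
proof -
  have "jacobi 2 (2 * int k + 1) 
     = (if (2 * int k + 1) mod 8 = 1 \<or> (2 * int k + 1) mod 8 = 7 then 1 else -1)" for k
  proof (induction k)
    case (Suc k)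
    define m where "m = 2 * int k + 1"
    have m: "m > 0" "odd m" "2 * int (Suc k) + 1 = m + 2" by (auto simp: m_def)
    have c: "coprime m (m + 2)"
      using m by (metis coprime_add_one_right coprime_commute coprime_iff_gcd_eq_1 
        coprime_left_2_iff_odd gcd_add2)
    \<comment> \<open>Of two odd numbers that differ by 2 one is 1 modulo 4, so reciprocity carries
      no sign here.\<close>
    have "jacobi m (m + 2) = jacobi (m + 2) m"
      using m c by (intro jacobi_reciprocity) (auto, presburger)
    also have "\<dots> = jacobi 2 m" by (rule jacobi_cong) (simp add: cong_def)
    finally have 1: "jacobi m (m + 2) = jacobi 2 m" .
    have "jacobi m (m + 2) = jacobi (-1 * 2) (m + 2)"
      by (rule jacobi_cong) (simp add: cong_iff_dvd_diff)
    also have "\<dots> = jacobi (-1) (m + 2) * jacobi 2 (m + 2)"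
      using m by (intro jacobi_mult_left) auto
    finally have "jacobi 2 m = (if (m + 2) mod 4 = 1 then 1 else -1) * jacobi 2 (m + 2)"
      using 1 m jacobi_minus_1[of "m + 2"] by simp
    moreover have "(m + 2) mod 4 = 1 \<longleftrightarrow> (m mod 8 = 3 \<or> m mod 8 = 7)"
      using m by presburger
    moreover have "((m + 2) mod 8 = 1 \<or> (m + 2) mod 8 = 7) \<longleftrightarrow> (m mod 8 = 7 \<or> m mod 8 = 5)"
      by presburger
    moreover have "m mod 8 = 1 \<or> m mod 8 = 3 \<or> m mod 8 = 5 \<or> m mod 8 = 7"
      using m by presburger
    moreover have "jacobi 2 m = (if m mod 8 = 1 \<or> m mod 8 = 7 then 1 else -1)"
      using Suc by (simp only: m_def)
    ultimately have "jacobi 2 (m + 2) = (if (m + 2) mod 8 = 1 \<or> (m + 2) mod 8 = 7 then 1 else -1)"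
      by (elim disjE) (simp_all only: if_True if_False refl simp_thms, simp_all)
    then show ?case by (simp only: m(3))
  qed simp
  moreover obtain k where "n = 2 * k + 1" using assms by (auto elim: oddE)
  moreover have "int (nat k) = k" using assms \<open>n = 2 * k + 1\<close> by simp
  ultimately show ?thesis by metis
qed

section \<open>Exponents \<open>y\<close> and \<open>z\<close> divisible by 4\<close>

text \<open>\<open>alt_sum e W l\<close> is the sum of \<open>(-1)^i 4^(l-1-i) e i W^i\<close> over \<open>i < l\<close>, that is \<open>4^(l-1)\<close> times the
  truncation of the power series with coefficients \<open>e i\<close> at \<open>-W/4\<close>. For the coefficients of
  \<open>(1 + V)^x / (1 - V)^z\<close> it expresses \<open>(4 - W)^x / (4 + W)^z\<close> modulo \<open>W^l\<close> without fractions.\<close>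

primrec alt_sum :: "(nat \<Rightarrow> int) \<Rightarrow> int \<Rightarrow> nat \<Rightarrow> int" where
  "alt_sum e W 0 = 0"
| "alt_sum e W (Suc l) = 4 * alt_sum e W l + (-1) ^ l * e l * W ^ l"

text \<open>Taking partial sums of coefficients divides the series by 1 - V, which is (4 + W)/4 at V
  = -W/4. The term in \<open>W ^ Suc l\<close> is what truncation leaves over.\<close>

lemma alt_sum_partial_sums:
  assumes "e' 0 = e 0" "\<And>i. e' (Suc i) = e (Suc i) + e' i"
  shows "(4 + W) * alt_sum e' W (Suc l) = 4 * alt_sum e W (Suc l) + (-1) ^ l * e' l * W ^ Suc l"
proof (induction l)
  case 0
  then show ?case using assms by (simp add: algebra_simps)
next
  case (Suc l)
  have "(4 + W) * alt_sum e' W (Suc (Suc l)) = 4 * ((4 + W) * alt_sum e' W (Suc l))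
      + (4 + W) * ((-1) ^ Suc l * e' (Suc l) * W ^ Suc l)"
    by (simp only: alt_sum.simps(2)[of _ _ "Suc l"] algebra_simps)
  also have "\<dots> = 4 * alt_sum e W (Suc (Suc l)) + (-1) ^ Suc l * e' (Suc l) * W ^ Suc (Suc l)"
    unfolding Suc alt_sum.simps(2)[of _ _ "Suc l"] assms(2) by (simp add: algebra_simps)
  finally show ?case .
qed

text \<open>The Pascal recursion multiplies the series by 1 + V, which is (4 - W)/4 at V = -W/4;
  again only one term is left over.\<close>

lemma alt_sum_pascal:
  assumes "e' 0 = e 0" "\<And>i. e' (Suc i) = e (Suc i) + e i"
  shows "4 * alt_sum e' W (Suc l) = (4 - W) * alt_sum e W (Suc l) + (-1) ^ l * e l * W ^ Suc l"
proof (induction l)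
  case 0
  then show ?case using assms by (simp add: algebra_simps)
next
  case (Suc l)
  have "4 * alt_sum e' W (Suc (Suc l)) = 4 * (4 * alt_sum e' W (Suc l))
      + 4 * ((-1) ^ Suc l * e' (Suc l) * W ^ Suc l)"
    by (simp only: alt_sum.simps(2)[of _ _ "Suc l"] algebra_simps)
  also have "\<dots> = (4 - W) * alt_sum e W (Suc (Suc l)) + (-1) ^ Suc l * e (Suc l) * W ^ Suc (Suc l)"
    unfolding Suc alt_sum.simps(2)[of _ _ "Suc l"] assms(2) by (simp add: algebra_simps)
  finally show ?case .
qed

text \<open>The coefficient of V^i in (1 + V)^x / (1 - V)^z. Once z > 0 the coefficients are
  positive and nondecreasing, so none of them vanishes and the last term of a truncation can
  dominate.\<close>

fun series_coeff :: "nat \<Rightarrow> nat \<Rightarrow> nat \<Rightarrow> int" where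
  "series_coeff x 0 i = int (x choose i)"
| "series_coeff x (Suc z) i = (\<Sum>j\<le>i. series_coeff x z j)"

lemma alt_sum_binomial_cong:
  "[4 ^ x * alt_sum (series_coeff x 0) W (Suc l) = 4 ^ l * (4 - W) ^ x] (mod W ^ Suc l)"
proof (induction x)
  case 0
  have "alt_sum (series_coeff 0 0) W (Suc l) = 4 ^ l" by (induction l) simp_all
  then show ?case by (simp only: power_0 mult_1 mult_1_right cong_refl)
next
  case (Suc x)
  let ?S = "\<lambda>x. alt_sum (series_coeff x 0) W (Suc l)"
  have "4 * ?S (Suc x) = (4 - W) * ?S x + (-1) ^ l * series_coeff x 0 l * W ^ Suc l"
    by (rule alt_sum_pascal) simp_all
  then have "4 ^ Suc x * ?S (Suc x)
      = 4 ^ x * ((4 - W) * ?S x + (-1) ^ l * series_coeff x 0 l * W ^ Suc l)"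
    by (metis mult.assoc power_Suc2)
  then have "4 ^ Suc x * ?S (Suc x) - 4 ^ l * (4 - W) ^ Suc x
      = (4 - W) * (4 ^ x * ?S x - 4 ^ l * (4 - W) ^ x)
        + W ^ Suc l * (4 ^ x * (-1) ^ l * series_coeff x 0 l)"
    by (simp only: power_Suc[of "4 - W" x] algebra_simps)
  moreover have "W ^ Suc l dvd 4 ^ x * ?S x - 4 ^ l * (4 - W) ^ x"
    using Suc by (simp only: cong_iff_dvd_diff)
  ultimately show ?case by (simp only: cong_iff_dvd_diff) (simp only: dvd_add dvd_mult dvd_triv_left)
qed

text \<open>This is 4^l (1 + V)^x / (1 - V)^z at V = -W/4 with all denominators multiplied out. Each
  step of the induction on \<open>z\<close> is one division by 1 - V.\<close>

lemma alt_sum_series_cong: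
  "[(4 + W) ^ z * (4 ^ x * alt_sum (series_coeff x z) W (Suc l)) = 4 ^ z * (4 ^ l * (4 - W) ^ x)]
     (mod W ^ Suc l)"
proof (induction z)
  case 0
  show ?case using alt_sum_binomial_cong[of x W l] by (simp only: power_0 mult_1)
next
  case (Suc z)
  let ?S = "\<lambda>z. alt_sum (series_coeff x z) W (Suc l)"
  have "(4 + W) * ?S (Suc z) = 4 * ?S z + (-1) ^ l * series_coeff x (Suc z) l * W ^ Suc l"
    by (rule alt_sum_partial_sums) (simp_all add: add.commute)
  moreover have "(4 + W) ^ Suc z * (4 ^ x * ?S (Suc z)) = (4 + W) ^ z * 4 ^ x * ((4 + W) * ?S (Suc z))"
    by (simp only: power_Suc ac_simps)
  ultimately have "(4 + W) ^ Suc z * (4 ^ x * ?S (Suc z)) - 4 ^ Suc z * (4 ^ l * (4 - W) ^ x)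
      = 4 * ((4 + W) ^ z * (4 ^ x * ?S z) - 4 ^ z * (4 ^ l * (4 - W) ^ x))
        + W ^ Suc l * ((4 + W) ^ z * 4 ^ x * (-1) ^ l * series_coeff x (Suc z) l)"
    by (simp only: power_Suc[of 4 z] algebra_simps)
  moreover have "W ^ Suc l dvd (4 + W) ^ z * (4 ^ x * ?S z) - 4 ^ z * (4 ^ l * (4 - W) ^ x)"
    using Suc by (simp only: cong_iff_dvd_diff)
  ultimately show ?case by (simp only: cong_iff_dvd_diff) (simp only: dvd_add dvd_mult dvd_triv_left)
qed

lemma series_coeff_nonneg: "series_coeff x z i \<ge> 0"
  by (induction z arbitrary: i) (auto intro: sum_nonneg)

section \<open>Size of the coefficients and of the truncated series\<close>

lemma series_coeff_mono: "series_coeff x (Suc z) i \<le> series_coeff x (Suc z) (Suc i)"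
  using series_coeff_nonneg[of x z "Suc i"] by simp

lemma series_coeff_ge_1: "series_coeff x (Suc z) i \<ge> 1"
proof (induction i)
  case 0
  show ?case by (induction z) simp_all
next
  case (Suc i)
  then show ?case using series_coeff_mono[of x z i] by linarith
qed

lemma binomial_bound: "2 ^ x * (x choose i) \<le> 3 ^ x * (2::nat) ^ i"
proof (induction x arbitrary: i)
  case 0
  then show ?case by (cases i) simp_all
next
  case (Suc x)
  show ?case
  proof (cases i)
    case 0
    then show ?thesis using power_mono[of "2::nat" 3 "Suc x"] by simp
  next
    case (Suc j)
    show ?thesis using Suc.IH[of j] Suc.IH[of "Suc j"] unfolding Suc
      by (simp add: algebra_simps)
  qed
qed

text \<open>At V = 1/2 all terms of (1 + V)^x / (1 - V)^z are nonnegative, so none exceeds the sum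
  (3/2)^x * 2^z.\<close>

lemma series_coeff_bound: "2 ^ x * series_coeff x z i \<le> 3 ^ x * 2 ^ (z + i)"
proof (induction z arbitrary: i)
  case 0
  have "int (2 ^ x * (x choose i)) \<le> int (3 ^ x * 2 ^ i)" using binomial_bound by (simp only: of_nat_le_iff)
  then show ?case by simp
next
  case (Suc z)
  show ?case
  proof (induction i)
    case 0
    have "(2::int) ^ x * series_coeff x z 0 \<le> 3 ^ x * 2 ^ z" using Suc[of 0] by simp
    also have "\<dots> \<le> 3 ^ x * (2 * 2 ^ z)" by simp
    finally show ?case by simp
  next
    case (Suc i)
    then show ?case using Suc.prems \<open>\<And>i. 2 ^ x * series_coeff x z i \<le> 3 ^ x * 2 ^ (z + i)\<close>[of "Suc i"]
      by (simp add: algebra_simps)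
  qed
qed

lemma dominant_term_bounds:
  fixes a t E :: int
  assumes "8 * \<bar>a\<bar> \<le> E" "\<bar>t\<bar> = E"
  shows "E \<le> 2 * \<bar>4 * a + t\<bar>" "2 * \<bar>4 * a + t\<bar> \<le> 3 * E"
proof -
  have "t = E \<or> t = - E" using assms(2) by linarith
  then show "E \<le> 2 * \<bar>4 * a + t\<bar>" "2 * \<bar>4 * a + t\<bar> \<le> 3 * E" using assms(1) by auto
qed

text \<open>Each new term outweighs all earlier ones. If the sum so far is at most an eighth of E =
  \<open>e l * W ^ l\<close>, then four times it is at most E/2, so the next sum is at most 3E/2.
  Eight times that is 12 E, which is where the bound 12 for \<open>W\<close> comes from.\<close>

lemma alt_sum_size:
  assumes "\<And>i. e i \<ge> 1" "\<And>i. e i \<le> e (Suc i)" "W \<ge> 12"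
  shows "8 * \<bar>alt_sum e W l\<bar> \<le> e l * W ^ l"
proof (induction l)
  case 0
  then show ?case using assms(1)[of 0] by simp
next
  case (Suc l)
  have p: "W ^ l > 0" using assms(3) by simp
  have "\<bar>(-1) ^ l * e l * W ^ l\<bar> = e l * W ^ l"
    using assms(1)[of l] assms(3) by (simp add: abs_mult power_abs)
  then have "8 * \<bar>alt_sum e W (Suc l)\<bar> \<le> 12 * (e l * W ^ l)"
    using dominant_term_bounds(2)[OF Suc] unfolding alt_sum.simps by fastforce
  also have "\<dots> \<le> W * (e l * W ^ l)"
    using assms(1)[of l] assms(3) p by (intro mult_right_mono) auto
  also have "\<dots> = e l * W ^ Suc l" by simp
  also have "\<dots> \<le> e (Suc l) * W ^ Suc l"
    using assms(2)[of l] p assms(3) by (intro mult_right_mono) auto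
  finally show ?case .
qed

text \<open>A nonzero multiple of \<open>W ^ Suc l\<close> is at least that large, and the
  truncation accounts for at most 3/2 of \<open>e l * W ^ l\<close>, so \<open>M\<close> supplies
  the rest. If the multiple is zero, \<open>M\<close> equals the absolute value of the truncation,
  which is at least half of its last term.\<close>

lemma alt_sum_lower_bound:
  assumes "\<And>i. e i \<ge> 1" "\<And>i. e i \<le> e (Suc i)" "W \<ge> 12" "3 * e l + 1 \<le> 2 * W"
    and "M \<ge> 0" "W ^ Suc l dvd M + alt_sum e W (Suc l)"
  shows "W ^ l \<le> 2 * M"
proof -
  have p: "W ^ l > 0" using assms(3) by simp
  have el: "W ^ l \<le> e l * W ^ l" using assms(1)[of l] p by simp
  have 1: "8 * \<bar>alt_sum e W l\<bar> \<le> e l * W ^ l" using alt_sum_size[of e W l] assms(1-3) by blast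
  have 2: "\<bar>(-1) ^ l * e l * W ^ l\<bar> = e l * W ^ l"
    using assms(1)[of l] assms(3) by (simp add: abs_mult power_abs)
  have lo: "e l * W ^ l \<le> 2 * \<bar>alt_sum e W (Suc l)\<bar>"
   and hi: "2 * \<bar>alt_sum e W (Suc l)\<bar> \<le> 3 * (e l * W ^ l)"
    using dominant_term_bounds[OF 1 2] unfolding alt_sum.simps .
  show ?thesis
  proof (cases "M + alt_sum e W (Suc l) = 0")
    case True
    then show ?thesis using lo el assms(5) by linarith
  next
    case False
    then have "W ^ Suc l \<le> \<bar>M + alt_sum e W (Suc l)\<bar>"
      using assms(3,6) zdvd_imp_le[of "W ^ Suc l" "\<bar>M + alt_sum e W (Suc l)\<bar>"] by auto
    moreover have "\<bar>M + alt_sum e W (Suc l)\<bar> \<le> M + \<bar>alt_sum e W (Suc l)\<bar>"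
      using assms(5) by linarith
    ultimately have "2 * W ^ Suc l \<le> 2 * M + 3 * (e l * W ^ l)"
      using hi by linarith
    moreover have "(3 * e l + 1) * W ^ l \<le> 2 * W * W ^ l"
      using assms(4) p by (intro mult_right_mono) auto
    ultimately show ?thesis by (simp add: algebra_simps)
  qed
qed

text \<open>\<open>T\<close> keeps the binomial terms with 2i < Y. Each contains at most u^(Y-1),
  and the remaining factors sum to at most (1 + 4)^q, hence the hypothesis on 5^q. As Y < 2q, a kept
  term has i < q and so a factor 4, which makes \<open>T\<close> even.\<close>

lemma truncated_binomial:
  fixes u :: int
  assumes "0 < Y" "Y < 2 * q" "5 ^ q < u"
  obtains T where "even T" "0 \<le> T" "T < u ^ Y" "[(u\<^sup>2 + 4) ^ q = T] (mod u ^ Y)"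
proof
  let ?f = "\<lambda>i. of_nat (q choose i) * (u\<^sup>2) ^ i * 4 ^ (q - i)"
  let ?T = "\<Sum>i\<in>{i\<in>{..q}. 2 * i < Y}. ?f i"
  have u: "u > 1" using assms(3) one_le_power[of "5::int" q] by linarith
  show "even ?T"
  proof (rule dvd_sum)
    fix i assume "i \<in> {i\<in>{..q}. 2 * i < Y}"
    then have "q - i > 0" using assms(2) by auto
    then show "2 dvd ?f i" by (auto simp: dvd_mult)
  qed
  show "0 \<le> ?T" using u by (intro sum_nonneg) auto
  have "?T \<le> (\<Sum>i\<in>{i\<in>{..q}. 2 * i < Y}. u ^ (Y - 1) * (of_nat (q choose i) * 1 ^ i * 4 ^ (q - i)))"
  proof (rule sum_mono)
    fix i assume "i \<in> {i\<in>{..q}. 2 * i < Y}"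
    then have "u ^ (2 * i) \<le> u ^ (Y - 1)" using u by (intro power_increasing) auto
    then have "u ^ (2 * i) * (of_nat (q choose i) * 4 ^ (q - i)) 
        \<le> u ^ (Y - 1) * (of_nat (q choose i) * 4 ^ (q - i))"
      by (intro mult_right_mono) auto
    moreover have "(u\<^sup>2) ^ i = u ^ (2 * i)" by (simp only: power_mult)
    ultimately show "?f i \<le> u ^ (Y - 1) * (of_nat (q choose i) * 1 ^ i * 4 ^ (q - i))"
      by (simp only: power_one mult_1_right ac_simps)
  qed
  also have "\<dots> \<le> (\<Sum>i\<le>q. u ^ (Y - 1) * (of_nat (q choose i) * 1 ^ i * 4 ^ (q - i)))"
    using u by (intro sum_mono2) auto
  also have "\<dots> = u ^ (Y - 1) * (1 + 4) ^ q"
    unfolding binomial_ring sum_distrib_left ..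
  also have "\<dots> < u ^ (Y - 1) * u" using assms(3) u by simp
  also have "\<dots> = u ^ Y" using assms(1) by (simp add: power_eq_if mult.commute)
  finally show "?T < u ^ Y" .
  have "(u\<^sup>2 + 4) ^ q = (\<Sum>i\<le>q. ?f i)" by (rule binomial_ring)
  also have "\<dots> = ?T + (\<Sum>i\<in>{i\<in>{..q}. \<not> 2 * i < Y}. ?f i)"
    by (subst sum.union_disjoint[symmetric]) (auto intro: sum.cong)
  finally have "(u\<^sup>2 + 4) ^ q - ?T = (\<Sum>i\<in>{i\<in>{..q}. \<not> 2 * i < Y}. ?f i)" by simp
  also have "u ^ Y dvd \<dots>"
  proof (rule dvd_sum)
    fix i assume "i \<in> {i\<in>{..q}. \<not> 2 * i < Y}"
    then have "u ^ Y dvd (u\<^sup>2) ^ i" unfolding power_mult[symmetric] by (intro le_imp_power_dvd) auto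
    then show "u ^ Y dvd ?f i" by (simp add: dvd_mult dvd_mult2)
  qed
  finally show "[(u\<^sup>2 + 4) ^ q = ?T] (mod u ^ Y)" by (simp add: cong_iff_dvd_diff)
qed

text \<open>The cofactor of r - s in r^x - s^x is a sum of x odd terms, hence odd.\<close>

lemma power_diff_odd_cofactor:
  fixes r s :: int
  assumes "odd r" "odd s" "odd x" "2 ^ k dvd r ^ x - s ^ x"
  shows "2 ^ k dvd r - s"
proof -
  have "r ^ x - s ^ x = (r - s) * (\<Sum>i<x. s ^ (x - Suc i) * r ^ i)"
    by (rule power_diff_sumr2)
  moreover have "odd (\<Sum>i<x. s ^ (x - Suc i) * r ^ i)"
    using assms by (simp add: even_sum_iff)
  ultimately show ?thesis using assms(4) by (simp add: coprime_dvd_mult_left_iff)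
qed

text \<open>The 2-adic valuation of \<open>r2 ^ x - r1 ^ x\<close> makes \<open>u\<close> exponentially large in the exponents. If
  \<open>4 * q - x\<close> is at least \<open>Y - q\<close>, then \<open>r1 ^ x\<close> is below \<open>u ^ Y\<close> and must equal the even truncation of
  \<open>(u\<^sup>2 + 4) ^ q\<close> modulo \<open>u ^ Y\<close>. Otherwise \<open>n ^ (4 * q - x)\<close> is too small for a number congruent to
  \<open>(u\<^sup>2 - 4) ^ x / (u\<^sup>2 + 4) ^ (4 * q)\<close> modulo a high power of \<open>u\<close>, because no coefficient of that
  series in \<open>u\<^sup>2\<close> vanishes.\<close>

lemma no_solution_exponents_div_4:
  fixes u n u1 u2 r1 r2 :: int and x q Y :: nat
  assumes u: "u \<ge> 3" "odd u" and x: "odd x" "x < 4 * q" and qY: "q < Y"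
    and pos: "u1 > 0" "u2 > 0" "r1 > 0" "r2 > 0" and n: "n > 1"
    and prod: "u1 * u2 = u\<^sup>2 - 4"
    and nu2: "n ^ (4 * q - x) = u2 ^ x"
    and u1x: "u1 ^ x = ((u\<^sup>2 + 4) ^ q) ^ 4 - ((4 * u) ^ Y * n ^ (Y - q)) ^ 4"
    and r1: "r1 ^ x = (u\<^sup>2 + 4) ^ q - (4 * u) ^ Y * n ^ (Y - q)"
    and r2: "r2 ^ x = (u\<^sup>2 + 4) ^ q + (4 * u) ^ Y * n ^ (Y - q)"
  shows False
proof -
  define c where "c = u\<^sup>2 + 4"
  define B where "B = Y - q"
  define d where "d = 4 * q - x"
  define F where "F = c ^ q"
  define E where "E = (4 * u) ^ Y * n ^ B"
  have u9: "u\<^sup>2 \<ge> 9" using u(1) power_mono[of 3 u 2] by simp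
  have c13: "c \<ge> 13" and c2u: "c \<le> 2 * u\<^sup>2" using u9 by (auto simp: c_def)
  have x0: "x > 0" and q0: "q > 0" and Y0: "Y > 0" and B0: "B > 0" and d0: "d > 0"
    using x qY odd_pos by (auto simp: B_def d_def)
  have Y_eq: "Y = q + B" using qY by (simp add: B_def)
  have d_eq: "x + d = 4 * q" using x by (simp add: d_def)
  have Fpos: "F > 0" using c13 by (simp add: F_def)
  have Epos: "E > 0" using u n by (simp add: E_def)
  have r1': "r1 ^ x = F - E" using r1 by (simp add: F_def E_def c_def B_def)
  have r2': "r2 ^ x = F + E" using r2 by (simp add: F_def E_def c_def B_def)
  have u1x': "u1 ^ x = F ^ 4 - E ^ 4" using u1x by (simp add: F_def E_def c_def B_def)
  have nd: "n ^ d = u2 ^ x" using nu2 by (simp add: d_def)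
  have r1pos: "r1 ^ x > 0" using pos by simp
  have EF: "E < F" using r1' r1pos by linarith

  \<comment> \<open>Together with u1 u2 = u^2 - 4 < c this bounds F^3 = c^(3q) by c^x, so x > 3q and
    d = 4q - x is smaller than q. What is left over in the comparison is the inequality
    \<open>small\<close>.\<close>
  have "r1 ^ x * F ^ 3 \<le> u1 ^ x"
  proof -
    have "F ^ 4 - E ^ 4 = (F - E) * (F ^ 3 + (F ^ 2 * E + F * E ^ 2 + E ^ 3))"
      by (simp add: algebra_simps eval_nat_numeral)
    also have "\<dots> \<ge> (F - E) * F ^ 3" using Fpos Epos EF
      by (intro mult_left_mono) auto
    finally show ?thesis by (simp only: u1x' r1')
  qed
  then have "r1 ^ x * F ^ 3 * n ^ d \<le> u1 ^ x * n ^ d" using n by (intro mult_right_mono) auto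
  also have "\<dots> = (u\<^sup>2 - 4) ^ x" by (simp add: nd power_mult_distrib[symmetric] prod)
  also have "\<dots> < c ^ x" using u9 x0 by (intro power_strict_mono) (auto simp: c_def)
  finally have main: "(r1 ^ x * n ^ d) * c ^ (3 * q) < c ^ x"
    by (simp add: F_def power_mult[symmetric] mult_ac)
  have rn1: "r1 ^ x * n ^ d \<ge> 1" using r1pos n by (simp add: int_one_le_iff_zero_less)
  have "c ^ (3 * q) \<le> (r1 ^ x * n ^ d) * c ^ (3 * q)" using rn1 c13 by simp
  then have "c ^ (3 * q) < c ^ x" using main by linarith
  then have x3q: "3 * q < x" using c13 by (simp add: power_strict_increasing_iff)
  have "c ^ x = c ^ (x - 3 * q) * c ^ (3 * q)" using x3q by (simp add: power_add[symmetric])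
  then have "(r1 ^ x * n ^ d) < c ^ (x - 3 * q)" using main c13 by simp
  then have "(r1 ^ x * n ^ d) * c ^ d < c ^ (x - 3 * q) * c ^ d" using c13 by simp
  moreover have "x - 3 * q + d = q" using x3q d_eq by linarith
  ultimately have small: "(r1 ^ x * n ^ d) * c ^ d < F" by (simp add: power_add[symmetric] F_def)

  have "even E" using Y0 by (simp add: E_def)
  have "odd F" using u by (simp add: F_def c_def)
  have r1odd: "odd r1" and r2odd: "odd r2"
    using r1' r2' \<open>even E\<close> \<open>odd F\<close> x0 by (metis even_add even_diff even_power)+
  \<comment> \<open>As x is odd, the power of 2 in r2^x - r1^x = 2E passes to r2 - r1. So r2 exceeds
    2^(2Y+1), although r2^x = F + E is below 2 c^q.\<close>
  have "(2::int) ^ (2 * Y + 1) dvd r2 ^ x - r1 ^ x"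
  proof -
    have "r2 ^ x - r1 ^ x = 2 * E" using r1' r2' by simp
    also have "\<dots> = 2 ^ (2 * Y + 1) * (u ^ Y * n ^ B)" 
      by (simp add: E_def power_mult_distrib power_mult)
    finally show ?thesis by simp
  qed
  then have "2 ^ (2 * Y + 1) dvd r2 - r1"
    using r1odd r2odd x(1) power_diff_odd_cofactor by blast
  moreover have "r2 > r1" using r1' r2' Epos pos power_less_imp_less_base[of r1 x r2] by linarith
  ultimately have r2big: "2 ^ (2 * Y + 1) < r2" using pos zdvd_imp_le[of "2 ^ (2 * Y + 1)" "r2 - r1"] by linarith
  have "((2::int) ^ (2 * Y + 1)) ^ x < r2 ^ x" using r2big x0 by (intro power_strict_mono) auto
  then have big: "2 ^ ((2 * Y + 1) * x) < 2 * c ^ q"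
    unfolding power_mult[of _ _ x] using r2' EF unfolding F_def by linarith
  \<comment> \<open>The power of 2 is spread over the q factors c; the summand 1 absorbs the 2 in
    front of \<open>c ^ q\<close>.\<close>
  have big': "2 ^ k < c" if "k * q + 1 \<le> (2 * Y + 1) * x" for k
  proof -
    have "2 * ((2::int) ^ k) ^ q = 2 ^ (k * q + 1)" by (simp add: power_mult)
    also have "\<dots> \<le> 2 ^ ((2 * Y + 1) * x)" using that by (intro power_increasing) auto
    finally have "((2::int) ^ k) ^ q < c ^ q" using big by linarith
    then show ?thesis using c13 by (intro power_less_imp_less_base[of "2 ^ k" q c]) auto
  qed
  have cY: "2 ^ (6 * Y + 3) < c"
  proof (rule big')
    have "(2 * Y + 1) * (3 * q + 1) \<le> (2 * Y + 1) * x" using x3q by (intro mult_le_mono2) simp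
    then show "(6 * Y + 3) * q + 1 \<le> (2 * Y + 1) * x" by (simp add: algebra_simps)
  qed
  \<comment> \<open>Y = q + B splits (2Y + 1)x into 2qx + 2Bx + x, and x > 3q bounds 2Bx below by
    6Bq. The exponent is chosen so as to dominate the series coefficient \<open>e l\<close> in the
    second case below.\<close>
  have cx: "2 ^ (2 * x + 6 * B + 2) < c"
  proof (rule big')
    have "B * (3 * q) \<le> B * x" using x3q by (intro mult_le_mono2) simp
    moreover have "(2 * x + 6 * B + 2) * q + 1 = 2 * (q * x) + 2 * (B * (3 * q)) + 2 * q + 1"
      by (simp add: algebra_simps)
    moreover have "(2 * Y + 1) * x = 2 * (q * x) + 2 * (B * x) + x" by (simp add: Y_eq algebra_simps)
    ultimately show "(2 * x + 6 * B + 2) * q + 1 \<le> (2 * Y + 1) * x" 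
      using x3q by linarith
  qed

  \<comment> \<open>Otherwise E would be at least (4u)^(2q), which is no smaller than (2u^2)^q and
    hence than F = c^q.\<close>
  have Y2q: "Y < 2 * q"
  proof (rule ccontr)
    assume "\<not> Y < 2 * q"
    then have "(4 * u) ^ (2 * q) \<le> (4 * u) ^ Y" using u by (intro power_increasing) auto
    also have "\<dots> \<le> E" using u n by (simp add: E_def)
    also have "\<dots> < (2 * u\<^sup>2) ^ q" using EF power_mono[OF c2u, of q] c13 by (simp add: F_def)
    also have "\<dots> \<le> ((4 * u)\<^sup>2) ^ q" using u by (intro power_mono) (auto simp: power2_eq_square)
    finally show False by (simp only: power_mult)
  qed

  have u_big: "2 ^ (3 * Y + 1) < u"
  proof -
    have "((2::int) ^ (3 * Y + 1))\<^sup>2 = 2 ^ (6 * Y + 2)" by (simp add: power_mult[symmetric] algebra_simps)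
    moreover have "2 * (2::int) ^ (6 * Y + 2) = 2 ^ (6 * Y + 3)" by (simp add: power_add)
    ultimately have "((2::int) ^ (3 * Y + 1))\<^sup>2 < u\<^sup>2" using cY c2u by linarith
    then show ?thesis using u by (intro power_less_imp_less_base[of "2 ^ (3 * Y + 1)" 2 u]) auto
  qed
  show False
  proof (cases "B \<le> d")
    case True
    have "n ^ B \<le> n ^ d" using True n by (intro power_increasing) auto
    then have "r1 ^ x * n ^ B * c ^ d \<le> r1 ^ x * n ^ d * c ^ d" 
      using r1pos c13 by (intro mult_right_mono mult_left_mono) auto
    then have "r1 ^ x * n ^ B * c ^ d * (4 * u) ^ Y < F * (4 * u) ^ Y"
      using small u by (intro mult_strict_right_mono) auto
    then have 1: "r1 ^ x * c ^ d * E < F * (4 * u) ^ Y" by (simp add: E_def mult_ac)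
    have cd: "c \<le> c ^ d" using c13 d0 by (simp add: self_le_power)
    \<comment> \<open>With r1^x = F - E at most F/2, E is at least F/2. So F can be cancelled
      against E in the previous bound, and c > 2^(2Y+1) then absorbs the powers of 2, leaving r1^x <
      u^Y.\<close>
    have "2 * r1 ^ x \<le> F"
    proof -
      have "r1 ^ x * 2 \<le> (r1 ^ x * n ^ d) * c ^ d"
        using cd c13 n r1pos by (intro mult_mono) auto
      then show ?thesis using small by linarith
    qed
    then have "F \<le> 2 * E" using r1' by linarith
    then have "r1 ^ x * c ^ d * F \<le> r1 ^ x * c ^ d * (2 * E)" 
      using r1pos c13 by (intro mult_left_mono) auto
    then have "F * (r1 ^ x * c ^ d) < F * (2 * (4 * u) ^ Y)" using 1 by (simp add: mult_ac)
    then have 2: "r1 ^ x * c ^ d < 2 * (4 * u) ^ Y" using Fpos by simp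
    have "c * r1 ^ x \<le> r1 ^ x * c ^ d" using cd r1pos by (simp add: mult.commute)
    also note 2
    also have "2 * (4 * u) ^ Y = 2 ^ (2 * Y + 1) * u ^ Y" by (simp add: power_mult_distrib power_mult)
    also have "\<dots> \<le> c * u ^ Y"
    proof (intro mult_right_mono)
      have "(2::int) ^ (2 * Y + 1) \<le> 2 ^ (6 * Y + 3)" by (intro power_increasing) auto
      then show "2 ^ (2 * Y + 1) \<le> c" using cY by linarith
    qed (use u in auto)
    finally have r1_small: "r1 ^ x < u ^ Y" using c13 by simp
    have "(5::int) ^ q \<le> 8 ^ q" by (intro power_mono) auto
    also have "\<dots> = 2 ^ (3 * q)" by (simp add: power_mult)
    also have "\<dots> \<le> 2 ^ (3 * Y + 1)" using qY by (intro power_increasing) auto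
    finally have "5 ^ q < u" using u_big by linarith
    then obtain T where T: "even T" "0 \<le> T" "T < u ^ Y" "[c ^ q = T] (mod u ^ Y)"
      using truncated_binomial[OF Y0 Y2q] c_def by blast
    have "[c ^ q = r1 ^ x] (mod u ^ Y)"
      using r1' by (simp add: cong_iff_dvd_diff F_def E_def power_mult_distrib)
    then have "[T = r1 ^ x] (mod u ^ Y)" using T(4) cong_trans cong_sym by blast
    then have "T = r1 ^ x" using T(2,3) r1_small r1pos cong_less_imp_eq_int by auto
    then show False using T(1) r1odd by simp
  next
    case False
    define W where "W = u\<^sup>2"
    \<comment> \<open>(2q - Y)/2 rounded up: W^l = u^(2l) reaches u^(2q-Y), roughly the size of c^q
      / u^Y that bounds n^B from above, while W^(l+1) still divides E^4.\<close>
    define l where "l = (2 * q - Y + 1) div 2"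
    define e where "e = series_coeff x (4 * q)"
    have l1: "2 * q \<le> Y + 2 * l" and l2: "2 * l + Y \<le> 2 * q + 1" using Y2q by (auto simp: l_def)
    have W9: "W \<ge> 12" 
    proof -
      have "(2::int) ^ 5 \<le> 2 ^ (6 * Y + 3)" using Y0 by (intro power_increasing) auto
      then show ?thesis using cY by (simp add: c_def W_def)
    qed
    have "3 * l \<le> x" using l2 x3q qY by linarith
    \<comment> \<open>Each factor 2 is grouped with three factors 3, possible as 3l is at most x: 27
      * 2 = 54 is below 64 = 4^3.\<close>
    have "(3::int) ^ x * 2 ^ l \<le> 4 ^ x"
    proof -
      have "(3::int) ^ x * 2 ^ l = 54 ^ l * 3 ^ (x - 3 * l)"
      proof -
        have "(54::int) ^ l = 27 ^ l * 2 ^ l" using power_mult_distrib[of "27::int" 2 l] by simp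
        moreover
        have "(3::int) ^ x = 3 ^ (3 * l) * 3 ^ (x - 3 * l)" using \<open>3 * l \<le> x\<close> by (simp add: power_add[symmetric])
        ultimately show ?thesis by (simp add: power_mult)
      qed
      also have "\<dots> \<le> 64 ^ l * 4 ^ (x - 3 * l)" by (intro mult_mono power_mono) auto
      also have "\<dots> = 4 ^ (3 * l) * 4 ^ (x - 3 * l)" by (simp add: power_mult)
      also have "\<dots> = 4 ^ x" using \<open>3 * l \<le> x\<close> by (simp add: power_add[symmetric])
      finally show ?thesis .
    qed
    then have *: "2 ^ (4 * q) * (3 ^ x * 2 ^ l) \<le> 2 ^ (4 * q) * (4::int) ^ x"
      by (rule mult_left_mono) simp
    have "2 ^ x * e l \<le> 2 ^ (4 * q) * (3 ^ x * 2 ^ l)"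
      using series_coeff_bound[of x "4 * q" l] by (simp only: e_def power_add ac_simps)
    also note *
    also have "(4::int) ^ x = 2 ^ x * 2 ^ x" using power_mult_distrib[of "2::int" 2 x] by simp
    finally have "2 ^ x * e l \<le> 2 ^ x * (2 ^ (4 * q + x))" by (simp add: power_add mult_ac)
    then have "e l \<le> 2 ^ (4 * q + x)" by simp
    then have "4 * e l \<le> 2 ^ (4 * q + x + 2)" by (simp add: power_add)
    also have "4 * q + x + 2 = 2 * x + d + 2" using d_eq by linarith
    also have "(2::int) ^ (2 * x + d + 2) \<le> 2 ^ (2 * x + 6 * B + 2)" using False by (intro power_increasing) auto
    finally have e_small: "4 * e l < c" using cx by linarith
    have e1: "e i \<ge> 1" "e i \<le> e (Suc i)" for i
    proof -
      obtain z where "4 * q = Suc z" using q0 by (metis gr0_implies_Suc mult_pos_pos zero_less_numeral)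
      then show "e i \<ge> 1" "e i \<le> e (Suc i)"
        using series_coeff_ge_1[of x z i] series_coeff_mono[of x z i] by (simp_all add: e_def)
    qed
    have e2W: "3 * e l + 1 \<le> 2 * W" using e_small e1(1)[of l] c2u unfolding W_def by linarith
    \<comment> \<open>As x is odd, (u1 u2)^x = -(4 - W)^x, so c^(4q) n^d is -(4 - W)^x up to a
      multiple of E^4. Modulo W^(l+1), n^d is therefore minus the series; 4^(d+l) is the denominator
      that remains after cancelling 4^x by x + d = 4q.\<close>
    have "W ^ Suc l dvd 4 ^ (d + l) * n ^ d + alt_sum e W (Suc l)"
    proof -
      have "W ^ Suc l dvd c ^ (4 * q) * n ^ d + (4 - W) ^ x"
      proof -
        have "c ^ (4 * q) * n ^ d = (u1 ^ x + E ^ 4) * n ^ d"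
          using u1x' by (simp add: F_def power_mult[symmetric] mult.commute)
        also have "\<dots> = (u1 * u2) ^ x + E ^ 4 * n ^ d"
          by (simp add: nd power_mult_distrib algebra_simps)
        also have "(u1 * u2) ^ x = - ((4 - W) ^ x)"
        proof -
          have "u1 * u2 = - (4 - W)" by (simp add: prod W_def)
          then have "(u1 * u2) ^ x = (- (4 - W)) ^ x" by (rule arg_cong)
          also have "\<dots> = - ((4 - W) ^ x)" using x(1) by (rule power_minus_odd)
          finally show ?thesis .
        qed
        finally have "c ^ (4 * q) * n ^ d + (4 - W) ^ x = E ^ 4 * n ^ d" by simp
        moreover have "W ^ Suc l dvd E ^ 4"
        proof -
          have "W ^ Suc l = u ^ (2 * Suc l)" by (simp only: W_def power_mult)
          also have "\<dots> dvd u ^ (Y * 4)" using l2 qY by (intro le_imp_power_dvd) auto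
          also have "\<dots> dvd E ^ 4" by (simp add: E_def power_mult_distrib power_mult)
          finally show ?thesis .
        qed
        ultimately show ?thesis by (simp add: dvd_mult2)
      qed
      then have "W ^ Suc l dvd 4 ^ (4 * q) * 4 ^ l * (c ^ (4 * q) * n ^ d + (4 - W) ^ x)"
        by (rule dvd_mult)
      moreover have "W ^ Suc l dvd (4 + W) ^ (4 * q) * (4 ^ x * alt_sum e W (Suc l)) 
          - 4 ^ (4 * q) * (4 ^ l * (4 - W) ^ x)"
        using alt_sum_series_cong[of W "4 * q" x l] unfolding e_def cong_iff_dvd_diff .
      ultimately have "W ^ Suc l dvd 4 ^ (4 * q) * 4 ^ l * (c ^ (4 * q) * n ^ d + (4 - W) ^ x) +
         ((4 + W) ^ (4 * q) * (4 ^ x * alt_sum e W (Suc l)) 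
          - 4 ^ (4 * q) * (4 ^ l * (4 - W) ^ x))" by (rule dvd_add)
      also have "4 ^ (4 * q) * 4 ^ l * (c ^ (4 * q) * n ^ d + (4 - W) ^ x) +
         ((4 + W) ^ (4 * q) * (4 ^ x * alt_sum e W (Suc l)) 
          - 4 ^ (4 * q) * (4 ^ l * (4 - W) ^ x))
        = (4 ^ x * (4 + W) ^ (4 * q)) * (4 ^ (d + l) * n ^ d + alt_sum e W (Suc l))"
      proof -
        have "(4::int) ^ (4 * q) = 4 ^ x * 4 ^ d" by (simp only: d_eq[symmetric] power_add)
        moreover have "c = 4 + W" by (simp add: c_def W_def)
        moreover have "X * D * L * (P * N + R) + (P * (X * S) - X * D * (L * R)) = X * P * (D * L * N + S)"
          for X D L P N R S :: int by (simp add: algebra_simps)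
        ultimately show ?thesis by (simp only: power_add)
      qed
      finally have "W ^ Suc l dvd (4 ^ x * (4 + W) ^ (4 * q)) * (4 ^ (d + l) * n ^ d + alt_sum e W (Suc l))" .
      moreover have "coprime (W ^ Suc l) (4 ^ x * (4 + W) ^ (4 * q))"
      proof -
        have "coprime u 2" using u by simp
        then have "coprime u (2 ^ 2)" by (simp only: coprime_power_right_iff simp_thms)
        then have "coprime W 4" by (simp add: W_def)
        moreover have "coprime W (4 + W)" using \<open>coprime W 4\<close> 
          using gcd_add2[of W 4] by (simp add: coprime_iff_gcd_eq_1 add.commute)
        ultimately show ?thesis
          unfolding coprime_mult_right_iff coprime_power_left_iff coprime_power_right_iff by blast
      qed
      ultimately show ?thesis by (simp add: coprime_dvd_mult_right_iff)
    qed
    then have "W ^ l \<le> 2 * (4 ^ (d + l) * n ^ d)"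
      using alt_sum_lower_bound[of e W l "4 ^ (d + l) * n ^ d"] e1 W9 e2W n by simp
    also have "\<dots> \<le> 2 * (4 ^ (d + l) * n ^ B)" 
      using False n by (intro mult_left_mono power_increasing) auto
    also have "(4::int) ^ (d + l) = 2 ^ (2 * d + 2 * l)" by (simp add: power_mult[symmetric] power_add power_mult)
    finally have 1: "W ^ l \<le> 2 ^ (2 * d + 2 * l + 1) * n ^ B" by simp
    \<comment> \<open>Multiplying by 2^q u^Y completes n^B to a divisor-sized part of E: d < B and
      the choice of l keep the total power of 2 within 2^(2Y).\<close>
    have "2 ^ (2 * d + 2 * l + 1) * n ^ B * (2 ^ q * u ^ Y) 
        = 2 ^ (2 * d + 2 * l + 1 + q) * (n ^ B * u ^ Y)" by (simp add: power_add mult_ac)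
    also have "\<dots> \<le> 2 ^ (2 * Y) * (n ^ B * u ^ Y)"
      using False l2 Y_eq n u by (intro mult_right_mono power_increasing) auto
    also have "\<dots> = E" by (simp add: E_def power_mult_distrib power_mult)
    also have "\<dots> < (2 * W) ^ q" using EF power_mono[OF c2u, of q] c13 by (simp add: F_def W_def)
    also have "\<dots> = 2 ^ q * u ^ (2 * q)" by (simp add: W_def power_mult_distrib power_mult)
    also have "\<dots> \<le> 2 ^ q * u ^ (Y + 2 * l)" using l1 u by (intro mult_left_mono power_increasing) auto
    also have "\<dots> = W ^ l * (2 ^ q * u ^ Y)" by (simp only: power_add W_def power_mult[symmetric] ac_simps)
    finally have "2 ^ (2 * d + 2 * l + 1) * n ^ B < W ^ l" 
      using u by (simp add: mult_less_cancel_right)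
    then show False using 1 by linarith
  qed
qed

section \<open>Powers and their differences\<close>

text \<open>Lifting the exponent at 2. For m = 2h the congruence r = s (mod 4) makes r^h + s^h twice
  an odd number, so every factor 2 of m contributes a single factor 2.\<close>

lemma two_power_dvd_power_diff:
  fixes r s :: int
  assumes "odd r" "odd s" "4 dvd r - s" "2 ^ k dvd r ^ m - s ^ m" "m > 0"
  shows "2 ^ k dvd (r - s) * int m"
  using assms(4,5)
proof (induction m arbitrary: k rule: less_induct)
  case (less m)
  show ?case
  proof (cases "odd m")
    case True
    then show ?thesis using power_diff_odd_cofactor[OF assms(1,2) True less.prems(1)] by simp
  next
    case False
    then obtain h where h: "m = 2 * h" by blast
    show ?thesis
    proof (cases k)
      case (Suc j)
      have "[r ^ h = s ^ h] (mod 4)"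
        using assms(3) by (intro cong_pow) (simp add: cong_iff_dvd_diff)
      then obtain t where t: "r ^ h - s ^ h = 4 * t" by (auto simp: cong_iff_dvd_diff)
      then have eq: "r ^ h + s ^ h = 2 * (s ^ h + 2 * t)" by simp
      have "r ^ m - s ^ m = (r ^ h - s ^ h) * (r ^ h + s ^ h)"
        unfolding h mult_2 power_add by (simp add: algebra_simps)
      also have "\<dots> = 2 * ((r ^ h - s ^ h) * (s ^ h + 2 * t))" by (simp only: eq ac_simps)
      finally have "2 ^ j dvd (r ^ h - s ^ h) * (s ^ h + 2 * t)" using less.prems(1) Suc by simp
      moreover have "coprime (2 ^ j) (s ^ h + 2 * t)" using assms(2) by simp
      ultimately have "2 ^ j dvd r ^ h - s ^ h" by (simp add: coprime_dvd_mult_left_iff)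
      then have "2 ^ j dvd (r - s) * int h" using less.IH[of h j] less.prems(2) h by simp
      then show ?thesis using Suc h by simp
    qed simp
  qed
qed

lemma nth_power_coprime_factors:
  fixes a b t :: int
  assumes "coprime a b" "a > 0" "b > 0" "a * b = t ^ k" "t > 0"
  obtains r s where "r > 0" "s > 0" "a = r ^ k" "b = s ^ k"
proof -
  have "int (nat a * nat b) = int (nat t ^ k)" using assms by (simp add: )
  then have "nat a * nat b = nat t ^ k" by (simp only: of_nat_eq_iff)
  then have "is_nth_power k (nat a * nat b)" by simp
  moreover have "coprime (nat a) (nat b)" using assms by (simp add: coprime_int_iff[symmetric])
  ultimately obtain r s where *: "nat a = r ^ k" "nat b = s ^ k"
    using is_nth_power_mult_coprime_natD[of "nat a" "nat b" k] assms by (auto elim!: is_nth_powerE)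
  show ?thesis
  proof (cases "k = 0")
    case True
    then show ?thesis using that[of 1 1] * assms by auto
  next
    case False
    have "a = int r ^ k" "b = int s ^ k" using * assms by (metis int_nat_eq less_imp_le of_nat_power)+
    moreover have "int r > 0" "int s > 0" using calculation assms(2,3) False by (auto simp: zero_less_power_eq)
    ultimately show ?thesis using that by blast
  qed
qed

lemma square_diff_nth_power:
  fixes G H t :: int
  assumes "0 \<le> H" "H < G" "coprime G H" "odd (G + H)" "G\<^sup>2 - H\<^sup>2 = t ^ k" "t > 0" "k > 0"
  obtains r s where "r > 0" "s > 0" "G - H = r ^ k" "G + H = s ^ k" "coprime r s" "t = r * s"
proof -
  have eq: "(G - H) * (G + H) = t ^ k" using assms(5) by (simp add: power2_eq_square algebra_simps)
  have cop: "coprime (G - H) (G + H)"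
  proof (rule coprimeI)
    fix d assume d: "d dvd G - H" "d dvd G + H"
    have "coprime 2 d" using d(2) assms(4) by (meson coprime_left_2_iff_odd dvd_trans)
    moreover have "d dvd 2 * G" "d dvd 2 * H"
      using dvd_add[OF d] dvd_diff[OF d(2) d(1)] by simp_all
    ultimately have "d dvd G" "d dvd H"
      by (simp_all add: coprime_dvd_mult_right_iff coprime_commute)
    then show "is_unit d" using assms(3) coprime_common_divisor by blast
  qed
  obtain r s where rs: "r > 0" "s > 0" "G - H = r ^ k" "G + H = s ^ k"
    using nth_power_coprime_factors[OF cop _ _ eq assms(6)] assms(1,2) by auto
  moreover have "coprime r s" using cop assms(7) unfolding rs by simp
  moreover have "t = r * s"
  proof -
    have "t ^ k = (r * s) ^ k" using eq unfolding rs power_mult_distrib ..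
    then show ?thesis using rs assms(6,7) by (simp add: power_eq_iff_eq_base)
  qed
  ultimately show ?thesis using that by blast
qed

text \<open>Level j + 1 for G, H is level j for G^2, H^2. So G^2 - H^2 is a k-th power, and then so
  is its factor G - H, which is coprime to G + H.\<close>

lemma power_two_power_diff_nth_power:
  fixes G H t :: int
  assumes "0 \<le> H" "H < G" "coprime G H" "odd G" "even H"
    "G ^ 2 ^ j - H ^ 2 ^ j = t ^ k" "t > 0" "k > 0"
  shows "\<exists>r>0. G - H = r ^ k"
  using assms
proof (induction j arbitrary: G H)
  case 0
  then show ?case by auto
next
  case (Suc j)
  have "(G\<^sup>2) ^ 2 ^ j - (H\<^sup>2) ^ 2 ^ j = t ^ k"
    using Suc.prems(6) by (simp add: power_mult)
  moreover have "H\<^sup>2 < G\<^sup>2" using Suc.prems by (intro power_strict_mono) auto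
  ultimately obtain r where r: "r > 0" "G\<^sup>2 - H\<^sup>2 = r ^ k"
    using Suc.IH[of "H\<^sup>2" "G\<^sup>2"] Suc.prems by auto
  then show ?case
    using square_diff_nth_power[of H G r k] Suc.prems by (metis odd_add)
qed

lemma odd_power_square_imp_square:
  fixes a b :: int
  assumes "a > 0" "odd k" "a ^ k = b\<^sup>2"
  obtains t where "t > 0" "a = t\<^sup>2"
proof -
  obtain m where m: "k = 2 * m + 1" using assms(2) by (rule oddE)
  have eq: "a * (a ^ m)\<^sup>2 = b\<^sup>2" using assms(3) by (simp add: m power_mult[symmetric] mult.commute)
  then have "(a ^ m)\<^sup>2 dvd b\<^sup>2" by (metis dvd_triv_right)
  then obtain t where t: "b = a ^ m * t" by auto
  then have "(a ^ m)\<^sup>2 * a = (a ^ m)\<^sup>2 * t\<^sup>2" using eq by (simp add: power_mult_distrib mult.commute)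
  then have "a = t\<^sup>2" using assms(1) by simp
  then show ?thesis using that[of "\<bar>t\<bar>"] assms(1) by auto
qed

text \<open>Square roots are taken s times: as k is odd, b^k can be a square only if b is
  one.\<close>

lemma power_eq_two_power_root:
  fixes a b :: int
  assumes "a > 0" "b > 0" "odd k" "a ^ (2 ^ s * m) = b ^ k"
  shows "\<exists>w>0. b = w ^ 2 ^ s \<and> w ^ k = a ^ m"
  using assms(2,4)
proof (induction s arbitrary: b)
  case 0
  then show ?case by auto
next
  case (Suc s)
  have "b ^ k = (a ^ (2 ^ s * m))\<^sup>2" using Suc.prems(2) by (simp add: power_mult[symmetric] mult_ac)
  then obtain t where t: "t > 0" "b = t\<^sup>2" using odd_power_square_imp_square[OF Suc.prems(1) assms(3)] by metis
  have "(t ^ k)\<^sup>2 = (a ^ (2 ^ s * m))\<^sup>2"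
    using \<open>b ^ k = _\<close> t(2) by (simp add: power_mult[symmetric] mult.commute)
  then have "a ^ (2 ^ s * m) = t ^ k" using t assms(1) by (simp add: power_eq_iff_eq_base)
  then obtain w where "w > 0" "t = w ^ 2 ^ s" "w ^ k = a ^ m" using Suc.IH[OF t(1)] by blast
  then show ?case using t(2) by (auto simp: power_mult[symmetric] mult.commute intro!: exI[of _ w])
qed

lemma odd_square_mod_8: "odd t \<Longrightarrow> [t\<^sup>2 = 1] (mod (8::int))"
proof -
  assume "odd t"
  then have "t mod 8 = 1 \<or> t mod 8 = 3 \<or> t mod 8 = 5 \<or> t mod 8 = 7" by presburger
  then have "(t mod 8)\<^sup>2 mod 8 = 1" by auto
  then show ?thesis by (simp add: cong_def power_mod)
qed

lemma even_power_mod_8: "odd t \<Longrightarrow> even k \<Longrightarrow> [t ^ k = 1] (mod (8::int))"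
  using cong_pow[OF odd_square_mod_8[of t], of "k div 2"] by (auto simp: power_mult[symmetric])

lemma odd_power_mod_8: "odd t \<Longrightarrow> odd k \<Longrightarrow> [t ^ k = t] (mod (8::int))"
  using cong_mult[OF cong_refl[of t 8] even_power_mod_8[of t "k - 1"]]
  by (cases k) auto

text \<open>c^(k+2) = c^k a^2 + c^k b^2 with a, b < c. It serves for the Pythagorean triple (u^2 -
  4, 4u, u^2 + 4).\<close>

lemma power_sum_less_of_square_sum:
  fixes a b c :: int
  assumes "a > 0" "b > 0" "c > 0" "a\<^sup>2 + b\<^sup>2 = c\<^sup>2"
  shows "a ^ (k + 2) + b ^ (k + 2) \<le> c ^ (k + 2)" "k > 0 \<Longrightarrow> a ^ (k + 2) + b ^ (k + 2) < c ^ (k + 2)"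
proof -
  have "a\<^sup>2 < c\<^sup>2" "b\<^sup>2 < c\<^sup>2" using assms by (simp_all add: assms(4)[symmetric])
  then have ac: "a < c" "b < c" using assms power_less_imp_less_base[of _ 2 c] by auto
  have eq: "c ^ (k + 2) = c ^ k * a\<^sup>2 + c ^ k * b\<^sup>2"
    unfolding power_add assms(4)[symmetric] by (simp add: distrib_left)
  have "a ^ k * a\<^sup>2 \<le> c ^ k * a\<^sup>2" "b ^ k * b\<^sup>2 \<le> c ^ k * b\<^sup>2"
    using assms ac by (auto intro!: mult_right_mono power_mono)
  then show "a ^ (k + 2) + b ^ (k + 2) \<le> c ^ (k + 2)" unfolding eq unfolding power_add by linarith
  assume "k > 0"
  then have "a ^ k * a\<^sup>2 < c ^ k * a\<^sup>2" "b ^ k * b\<^sup>2 < c ^ k * b\<^sup>2"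
    using assms ac by (auto intro!: mult_strict_right_mono power_strict_mono)
  then show "a ^ (k + 2) + b ^ (k + 2) < c ^ (k + 2)" unfolding eq unfolding power_add by linarith
qed

lemma coprime_sum_of_dvd_diff:
  fixes G H h :: int
  assumes "odd h" "coprime G H" "h dvd G - H"
  shows "coprime h (G + H)"
proof (rule coprimeI)
  fix d assume d: "d dvd h" "d dvd G + H"
  have "coprime 2 d" using d(1) assms(1) by (meson coprime_left_2_iff_odd dvd_trans)
  moreover have "d dvd 2 * G" "d dvd 2 * H"
    using dvd_add[OF d(2) dvd_trans[OF d(1) assms(3)]] dvd_diff[OF d(2) dvd_trans[OF d(1) assms(3)]]
    by simp_all
  ultimately have "d dvd G" "d dvd H"
    by (simp_all add: coprime_dvd_mult_right_iff coprime_commute)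
  then show "is_unit d" using assms(2) coprime_common_divisor by blast
qed

text \<open>The factor A + B = 2h appears at the bottom. Every later factor A^(2^i) + B^(2^i) is
  coprime to h, because h is odd and divides the corresponding difference.\<close>

lemma two_power_diff_coprime_cofactor:
  fixes A B h :: int
  assumes "odd h" "coprime A B" "A + B = 2 * h"
  shows "\<exists>Q. A ^ 2 ^ Suc k - B ^ 2 ^ Suc k = h * (2 * Q) \<and> coprime h Q"
proof (induction k)
  case 0
  have "coprime h (A + (- B))" using assms by (intro coprime_sum_of_dvd_diff) auto
  moreover have "A ^ 2 ^ Suc 0 - B ^ 2 ^ Suc 0 = h * (2 * (A - B))"
  proof -
    have "A ^ 2 ^ Suc 0 - B ^ 2 ^ Suc 0 = (A + B) * (A - B)" by (simp add: power2_eq_square algebra_simps)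
    then show ?thesis unfolding assms(3) by simp
  qed
  ultimately show ?case by (intro exI[of _ "A - B"]) simp
next
  case (Suc k)
  then obtain Q where Q: "A ^ 2 ^ Suc k - B ^ 2 ^ Suc k = h * (2 * Q)" "coprime h Q" by blast
  let ?S = "A ^ 2 ^ Suc k + B ^ 2 ^ Suc k"
  have "coprime h ?S" using assms Q(1) by (intro coprime_sum_of_dvd_diff) auto
  moreover have "A ^ 2 ^ Suc (Suc k) - B ^ 2 ^ Suc (Suc k) = h * (2 * (Q * ?S))"
  proof -
    have "G ^ 2 ^ Suc (Suc k) = (G ^ 2 ^ Suc k)\<^sup>2" for G :: int
      by (simp add: power_mult[symmetric] mult.commute)
    then have "A ^ 2 ^ Suc (Suc k) - B ^ 2 ^ Suc (Suc k) = (A ^ 2 ^ Suc k - B ^ 2 ^ Suc k) * ?S"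
      by (simp only: power2_eq_square algebra_simps)
    then show ?thesis unfolding Q(1) by (simp only: ac_simps)
  qed
  ultimately show ?case using Q(2) by (intro exI[of _ "Q * ?S"]) simp
qed

text \<open>A^2 - B^2 has exactly three factors 2, and lifting the exponent from A^2, B^2 adds
  exactly j more.\<close>

lemma two_power_diff_valuation:
  fixes A B :: int
  assumes "odd A" "odd B" "(A\<^sup>2 - B\<^sup>2) mod 16 = 8" "2 ^ k dvd A ^ 2 ^ Suc j - B ^ 2 ^ Suc j"
  shows "k \<le> j + 3"
proof -
  obtain t where "A\<^sup>2 - B\<^sup>2 = 16 * t + 8" using assms(3) by (metis mult_div_mod_eq)
  then have t: "A\<^sup>2 - B\<^sup>2 = 2 ^ 3 * (2 * t + 1)" by simp
  have "(A\<^sup>2) ^ 2 ^ j - (B\<^sup>2) ^ 2 ^ j = A ^ 2 ^ Suc j - B ^ 2 ^ Suc j" by (simp add: power_mult)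
  then have "2 ^ k dvd (A\<^sup>2) ^ 2 ^ j - (B\<^sup>2) ^ 2 ^ j" using assms(4) by (simp only:)
  then have "2 ^ k dvd (A\<^sup>2 - B\<^sup>2) * int (2 ^ j)"
    using assms(1,2) t by (intro two_power_dvd_power_diff) auto
  moreover have "(A\<^sup>2 - B\<^sup>2) * int (2 ^ j) = 2 ^ (j + 3) * (2 * t + 1)"
    unfolding t by (simp add: power_add)
  ultimately have "2 ^ k dvd 2 ^ (j + 3) * (2 * t + 1)" by metis
  moreover have "coprime (2 ^ k) (2 * t + 1)" by simp
  ultimately have "(2::int) ^ k dvd 2 ^ (j + 3)" by (simp only: coprime_dvd_mult_left_iff)
  then have "(2::int) ^ k \<le> 2 ^ (j + 3)" by (intro zdvd_imp_le) auto
  then show ?thesis by (simp only: power_increasing_iff[of "2::int"])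
qed

lemma odd_mod_8_cases: "odd (t::int) \<Longrightarrow> t mod 8 = 1 \<or> t mod 8 = 3 \<or> t mod 8 = 5 \<or> t mod 8 = 7"
  by presburger

lemma multiplicity_2_power_mult:
  "odd (m::nat) \<Longrightarrow> multiplicity 2 (2 ^ k * m) = k" 
  by (rule multiplicity_eqI) simp_all

lemma two_power_decomposition:
  assumes "(m::nat) > 0"
  obtains k where "m = 2 ^ multiplicity 2 m * k" "odd k"
  using multiplicity_decompose'[of m 2] assms by auto

section \<open>Exceptional solutions\<close>

text \<open>If z were at most x, the truncated difference z - x would be 0, so u2 = 1 and u1 = a.
  The decomposition then reads c^z = b^y n^(y-z) + a^x, which is played off against the equation
  divided by powers of n.\<close>

lemma exceptional_exponents_order:
  assumes "prime u" "odd u" "exceptional u x y z n" "associated_decomposition u x y z n u1 u2"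
  shows "x < z" "z < y"
proof -
  define a b c where "a = u\<^sup>2 - 4" and "b = 4 * u" and "c = u\<^sup>2 + 4"
  have u3: "u \<ge> 3" using odd_prime_int_gt_2[OF assms(1,2)] by linarith
  have "u\<^sup>2 \<ge> 9" using u3 power_mono[of 3 u 2] by simp
  then have a5: "a \<ge> 5" and b: "b \<ge> 12" and c: "c \<ge> 13" and ac: "a < c" "c - a = 8"
    using u3 by (auto simp: a_def b_def c_def)
  have pyth: "a\<^sup>2 + b\<^sup>2 = c\<^sup>2"
    by (simp add: a_def b_def c_def power2_eq_square algebra_simps)
  have "0 < a\<^sup>2" using a5 by simp
  then have "b\<^sup>2 < c\<^sup>2" using pyth by linarith
  then have bc: "b < c" using b c power_less_imp_less_base[of b 2 c] by auto
  have n: "n > 1" and ne: "(x, y, z) \<noteq> (2, 2, 2)" and pos: "x > 0" "y > 0" "z > 0"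
    and eq: "(a * n) ^ x + (b * n) ^ y = (c * n) ^ z"
    using assms(3) by (auto simp: exceptional_def is_solution_def a_def b_def c_def)
  have u12: "u1 > 0" "u2 > 0" "u1 * u2 = a" "c ^ z - b ^ y * n ^ (y - z) = u1 ^ x"
    and nu: "n ^ (z - x) = u2 ^ x"
    using assms(4) by (auto simp: associated_decomposition_def a_def b_def c_def)
  have odd: "odd a" "odd c" using assms(2) by (auto simp: a_def c_def)
  have cop: "coprime a b"
  proof -
    have "coprime u 2" using assms(2) by simp
    then have c4: "coprime u 4" "coprime 4 u" 
      using coprime_power_right_iff[of u 2 2] by (simp_all add: coprime_commute)
    have "coprime a u"
    proof (rule coprimeI)
      fix d assume "d dvd a" "d dvd u"
      then have "d dvd u * u - a" by (intro dvd_diff) auto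
      then have "d dvd 4" by (simp add: a_def power2_eq_square)
      then show "is_unit d" using c4 \<open>d dvd u\<close> coprime_common_divisor by blast
    qed
    moreover have "coprime a 2" using odd(1) by simp
    then have "coprime a 4" using coprime_power_right_iff[of a 2 2] by simp
    ultimately show ?thesis unfolding b_def by simp
  qed
  show xz: "x < z"
  proof (rule ccontr)
    assume "\<not> x < z"
    then have zx: "z \<le> x" by simp
    then have "u2 ^ x = 1" using nu by simp
    then have "u2 = 1" using u12(2) pos(1) power_eq_iff_eq_base[of x u2 1] by simp
    then have D: "c ^ z = b ^ y * n ^ (y - z) + a ^ x" using u12(3,4) by simp
    show False
    proof (cases "y < z")
      case True
      then have "c ^ z = b ^ y + a ^ x" using D by simp
      then have "a ^ x * n ^ x + b ^ y * n ^ y = b ^ y * n ^ z + a ^ x * n ^ z"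
        using eq by (simp add: power_mult_distrib algebra_simps)
      then have e1: "a ^ x * (n ^ x - n ^ z) = b ^ y * (n ^ z - n ^ y)" by (simp add: algebra_simps)
      have "n ^ z = n ^ y * n ^ (z - y)" "n ^ x = n ^ y * (n ^ (z - y) * n ^ (x - z))"
        using True zx by (simp_all add: power_add[symmetric])
      then have "n ^ y * (a ^ x * (n ^ (z - y) * (n ^ (x - z) - 1))) = n ^ y * (b ^ y * (n ^ (z - y) - 1))"
        using e1 by (simp add: algebra_simps)
      then have e2: "a ^ x * (n ^ (z - y) * (n ^ (x - z) - 1)) = b ^ y * (n ^ (z - y) - 1)"
        using n by simp
      \<comment> \<open>N is coprime to N - 1 and a to b, so \<open>e2\<close> gives both a^x < N
        and N dividing b^y. Then c^z = a^x + b^y is below 2 b^y, too small for z > y.\<close>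
      define N where "N = n ^ (z - y)"
      have N: "N > 1" using n True by (simp add: N_def)
      have "a ^ x dvd b ^ y * (N - 1)" using e2 by (metis N_def dvd_triv_left)
      then have "a ^ x dvd N - 1" using cop by (simp add: coprime_dvd_mult_right_iff)
      then have l1: "a ^ x < N" using N zdvd_imp_le by fastforce
      have "N dvd b ^ y * (N - 1)" using e2 by (metis N_def dvd_triv_left dvd_mult)
      moreover have "coprime N (N - 1)" by simp
      ultimately have "N dvd b ^ y" by (simp add: coprime_dvd_mult_left_iff)
      then have "N \<le> b ^ y" using b zdvd_imp_le by fastforce
      then have "c ^ z < 2 * b ^ y" using l1 \<open>c ^ z = b ^ y + a ^ x\<close> by linarith
      also have "\<dots> \<le> c * c ^ y" using bc b c by (intro mult_mono power_mono) auto
      also have "\<dots> = c ^ Suc y" by simp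
      also have "\<dots> \<le> c ^ z" using True c by (intro power_increasing) auto
      finally show False by simp
    next
      case False
      have "n ^ y = n ^ z * n ^ (y - z)" using False by (simp add: power_add[symmetric])
      then have "a ^ x * n ^ x = a ^ x * n ^ z"
        using eq D by (simp add: power_mult_distrib algebra_simps)
      then have "x = z" using a5 n by simp
      show False
      proof (cases "y = z")
        case True
        then have e: "a ^ z + b ^ z = c ^ z" using D \<open>x = z\<close> by simp
        have "z \<noteq> 2" using ne True \<open>x = z\<close> by auto
        have "z \<noteq> 1"
        proof
          assume "z = 1"
          then have "(a + b)\<^sup>2 = a\<^sup>2 + b\<^sup>2" using e pyth by simp
          then show False using a5 b by (simp add: power2_sum)
        qed
        then obtain k where "z = k + 2" "k > 0" using \<open>z \<noteq> 2\<close> pos(3)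
          by (metis Suc_1 add_2_eq_Suc' less_one linorder_neqE_nat not0_implies_Suc not_less_eq One_nat_def gr0I)
        then show False using power_sum_less_of_square_sum(2)[of a b c k] pyth a5 b c e by simp
      next
        case neq: False
        \<comment> \<open>As c - a = 8, lifting the exponent leaves at most 8z for a power of 2 that
          is at least 2^(2z+2).\<close>
        have "c ^ z - a ^ z = 2 ^ (2 * y) * (u ^ y * n ^ (y - z))"
          using D \<open>x = z\<close> by (simp add: b_def power_mult_distrib power_mult)
        then have "2 ^ (2 * y) dvd c ^ z - a ^ z" by simp
        then have "2 ^ (2 * y) dvd (c - a) * int z"
          using two_power_dvd_power_diff[of c a "2 * y" z] odd ac pos by simp
        then have "2 ^ (2 * y) \<le> 8 * int z" using ac pos zdvd_imp_le by simp
        moreover have "(2::int) ^ (2 * z + 2) \<le> 2 ^ (2 * y)"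
          using neq False by (intro power_increasing) auto
        moreover have "8 * int z < 2 ^ (2 * z + 2)"
        proof -
          have "2 * z < 2 ^ (2 * z)" by (rule less_exp)
          then have "int (2 * z) < int (2 ^ (2 * z))" by (simp only: of_nat_less_iff)
          then show ?thesis by simp
        qed
        ultimately show False by linarith
      qed
    qed
  qed
  show "z < y"
  proof (rule ccontr)
    assume "\<not> z < y"
    then consider "y < z" | "y = z" by linarith
    then show False
    proof cases
      case 1
      have cn: "c * n > 2" using c n by (smt (verit) mult_less_cancel_left1)
      have "(a * n) ^ x \<le> (c * n) ^ x" using a5 ac n by (intro power_mono) auto
      also have "\<dots> \<le> (c * n) ^ (z - 1)" using xz cn by (intro power_increasing) auto
      finally have 2: "(a * n) ^ x \<le> (c * n) ^ (z - 1)" .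
      have "(b * n) ^ y \<le> (c * n) ^ y" using b bc n by (intro power_mono) auto
      also have "\<dots> \<le> (c * n) ^ (z - 1)" using 1 cn by (intro power_increasing) auto
      finally have "(c * n) ^ z \<le> 2 * (c * n) ^ (z - 1)" using 2 eq by linarith
      moreover have "(c * n) ^ z = (c * n) * (c * n) ^ (z - 1)" using pos by (simp add: power_eq_if)
      moreover have "(c * n) ^ (z - 1) > 0" using cn by simp
      ultimately show False using cn by simp
    next
      case 2
      \<comment> \<open>For y = z the size of u1 decides: u1^x is at most a^x < a^z, whereas the
        Pythagorean triple gives c^z - b^z at least a^z.\<close>
      then have e: "c ^ z - b ^ z = u1 ^ x" using u12(4) by simp
      have "u1 * 1 \<le> u1 * u2" using u12(1,2) by (intro mult_left_mono) auto
      then have "u1 \<le> a" using u12(3) by simp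
      then have "u1 ^ x \<le> a ^ x" using u12(1) by (intro power_mono) auto
      also have "\<dots> < a ^ z" using xz a5 by (intro power_strict_increasing) auto
      finally have "u1 ^ x < a ^ z" .
      moreover obtain k where "z = k + 2" using xz pos(1)
        by (metis add.commute less_eqE Suc_leI Suc_1 One_nat_def le_less_trans)
      ultimately show False
        using power_sum_less_of_square_sum(1)[of a b c k] pyth a5 b c e by simp
    qed
  qed
qed

locale exceptional_solution =
  fixes u n u1 u2 :: int and x y z :: nat
  assumes prime_u: "prime u" and odd_u: "odd u" and n_gt_1: "n > 1" and x_pos: "x > 0"
    and x_less_z: "x < z" and z_less_y: "z < y"
    and u1_pos: "u1 > 0" and u2_pos: "u2 > 0" and coprime_u1_u2: "coprime u1 u2"
    and u1_u2: "u1 * u2 = u\<^sup>2 - 4"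
    and u1_power: "u1 ^ x + (4 * u) ^ y * n ^ (y - z) = (u\<^sup>2 + 4) ^ z"
    and n_power: "n ^ (z - x) = u2 ^ x"
begin

definition c where "c = u\<^sup>2 + 4"

lemma u_ge_3: "u \<ge> 3"
  using odd_prime_int_gt_2[OF prime_u odd_u] by linarith

lemma c_pos: "c > 0" by (simp add: c_def add_nonneg_pos)

lemma u_not_dvd_4: "\<not> u dvd 4"
proof
  assume "u dvd 4"
  then have "u dvd 2 ^ 2" by simp
  then have "u dvd 2" using prime_u prime_dvd_power by blast
  then show False using u_ge_3 zdvd_imp_le by fastforce
qed

lemma u_square_mod_8: "[u\<^sup>2 = 1] (mod 8)"
  using odd_u by (rule odd_square_mod_8)

lemma c_mod_8: "c mod 8 = 5"
  using cong_add[OF u_square_mod_8 cong_refl[of 4]] by (simp add: c_def cong_def)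

lemma odd_c: "odd c" using odd_u by (simp add: c_def)

lemma u1_u2_mod_8: "[u1 * u2 = 5] (mod 8)"
  using cong_diff[OF u_square_mod_8 cong_refl[of 4]] by (simp add: u1_u2 cong_def)

lemma odd_u1: "odd u1" and odd_u2: "odd u2"
proof -
  have "odd (u1 * u2)" using odd_u by (simp add: u1_u2)
  then show "odd u1" "odd u2" by auto
qed

lemma prime_dvd_n_iff: "prime p \<Longrightarrow> p dvd n \<longleftrightarrow> p dvd u2"
proof -
  assume p: "prime p"
  have "p dvd n \<longleftrightarrow> p dvd n ^ (z - x)" using p x_less_z by (simp add: prime_dvd_power_iff)
  also have "\<dots> \<longleftrightarrow> p dvd u2" using p x_pos by (simp add: n_power prime_dvd_power_iff)
  finally show ?thesis .
qed

lemma eqn: "u1 ^ x + (4 * u) ^ y * n ^ (y - z) = c ^ z"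
  using u1_power by (simp add: c_def)

section \<open>Symbols at the primes dividing \<open>c\<close>\<close>

lemma prime_dvd_c:
  assumes "prime p" "p dvd c"
  shows "odd p" "\<not> p dvd 2" "\<not> p dvd u" "\<not> p dvd u1" "\<not> p dvd u2" "\<not> p dvd n"
proof -
  show "odd p" using assms(2) odd_c dvd_trans by blast
  then show 2: "\<not> p dvd 2" using odd_prime_int_gt_2[OF assms(1)] zdvd_imp_le by fastforce
  have 8: "\<not> p dvd 2 ^ k" for k using 2 assms(1) prime_dvd_power by blast
  show "\<not> p dvd u"
  proof
    assume "p dvd u"
    then have "p dvd c - u * u" using assms(2) by (intro dvd_diff) auto
    then show False using 8[of 2] by (simp add: c_def power2_eq_square)
  qed
  have "\<not> p dvd u1 * u2"
  proof
    assume "p dvd u1 * u2"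
    then have "p dvd c - u1 * u2" using assms(2) by (intro dvd_diff) auto
    then show False using 8[of 3] by (simp add: c_def u1_u2)
  qed
  then show "\<not> p dvd u1" "\<not> p dvd u2" by auto
  then show "\<not> p dvd n" using assms(1) prime_dvd_n_iff by simp
qed

lemma Legendre_minus_1_c:
  assumes "prime p" "p dvd c"
  shows "Legendre (-1) p = 1"
proof -
  note p = prime_dvd_c[OF assms]
  have "Legendre (-1) p = Legendre (-1) p * Legendre (2\<^sup>2) p"
    using Legendre_square[OF assms(1) p(2)] by simp
  also have "\<dots> = Legendre (-1 * 2\<^sup>2) p" by (rule Legendre_mult[OF assms(1) p(1), symmetric])
  also have "\<dots> = Legendre (u\<^sup>2) p"
  proof (rule Legendre_cong[OF cong_sym])
    show "[u\<^sup>2 = -1 * 2\<^sup>2] (mod p)" using assms(2) by (simp add: cong_iff_dvd_diff c_def)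
  qed
  finally show ?thesis using Legendre_square[OF assms(1) p(3)] by simp
qed

lemma Legendre_4u_c:
  assumes "prime p" "p dvd c"
  shows "Legendre (4 * u) p = 1"
proof -
  note p = prime_dvd_c[OF assms]
  have eq: "(u + 2)\<^sup>2 - 4 * u = c" by (simp add: c_def power2_eq_square algebra_simps)
  have "\<not> p dvd u + 2"
  proof
    assume "p dvd u + 2"
    then have "p dvd (u + 2)\<^sup>2 - c" using assms(2) by (intro dvd_diff) (auto simp: power2_eq_square)
    then have "p dvd 4 * u" using eq by (simp add: algebra_simps)
    then have "p dvd 2 * (2 * u)" by simp
    then show False using p(2,3) assms(1) by (simp only: prime_dvd_mult_iff) simp
  qed
  then have "Legendre ((u + 2)\<^sup>2) p = 1" using Legendre_square assms(1) by blast
  moreover have "[(u + 2)\<^sup>2 = 4 * u] (mod p)" using assms(2) eq by (simp add: cong_iff_dvd_diff)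
  ultimately show ?thesis using Legendre_cong[of "(u + 2)\<^sup>2" "4 * u" p] by simp
qed

text \<open>At a prime divisor of c both -1 and 4u are squares, so of a term such as (4u)^y n^(y-z)
  only the power of n remains visible.\<close>

lemma Legendre_c:
  assumes "prime p" "p dvd c" "[t = - ((4 * u) ^ k * N)] (mod p)"
  shows "Legendre t p = Legendre N p"
proof -
  note p = prime_dvd_c[OF assms(1,2)]
  have "Legendre t p = Legendre (-1 * ((4 * u) ^ k * N)) p" using Legendre_cong[OF assms(3)] by simp
  also have "\<dots> = Legendre N p" 
    unfolding Legendre_mult[OF assms(1) p(1), of "-1"] Legendre_mult[OF assms(1) p(1), of "(4 * u) ^ k"]
      Legendre_power[OF assms(1) p(1)]
      Legendre_minus_1_c[OF assms(1,2)] Legendre_4u_c[OF assms(1,2)] by simp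
  finally show ?thesis .
qed

lemma Legendre_u1_u2_c:
  assumes "prime p" "p dvd c"
  shows "Legendre u1 p * Legendre u2 p = Legendre 2 p"
proof -
  note p = prime_dvd_c[OF assms]
  have "Legendre u1 p * Legendre u2 p = Legendre (u1 * u2) p"
    using Legendre_mult[OF assms(1) p(1)] by simp
  also have "\<dots> = Legendre (-1 * 2 ^ 3) p"
    using assms(2) by (intro Legendre_cong) (simp add: cong_iff_dvd_diff u1_u2 c_def add.commute)
  also have "\<dots> = Legendre 2 p"
    unfolding Legendre_mult[OF assms(1) p(1)] Legendre_minus_1_c[OF assms]
    using Legendre_power_odd[OF assms(1) p(1), of 3 2] by simp
  finally show ?thesis .
qed

lemma Legendre_u1_power_c:
  assumes "prime p" "p dvd c"
  shows "Legendre (u1 ^ x) p = Legendre (n ^ (y - z)) p"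
proof (rule Legendre_c[OF assms])
  have "p dvd c ^ z" using assms(2) x_less_z by (simp add: dvd_power_iff_le dvd_trans[OF assms(2)])
  then show "[u1 ^ x = - ((4 * u) ^ y * n ^ (y - z))] (mod p)"
    using eqn by (simp add: cong_iff_dvd_diff)
qed

lemma Legendre_u2_power_c:
  "Legendre (n ^ (z - x)) p = Legendre (u2 ^ x) p"
  by (simp add: n_power)

lemma jacobi_2_c: "jacobi 2 c = -1"
  using jacobi_2[OF c_pos odd_c] c_mod_8 by simp

lemma nonresidue_2_c:
  obtains p where "prime p" "p dvd c" "Legendre 2 p \<noteq> 1"
  using jacobi_eq_1[of c 2] jacobi_2_c by auto

text \<open>Turns symbols at the primes of \<open>c\<close> into a residue modulo 8; it serves for
  \<open>w\<close>, \<open>u2\<close> and the factor \<open>t1\<close> of \<open>u1\<close>.\<close>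

lemma jacobi_divisor_c:
  assumes "t > 0" "t dvd u\<^sup>2 - 4"
  shows "jacobi t c = jacobi 2 t"
proof -
  have "odd (u\<^sup>2 - 4)" using odd_u by simp
  then have t: "odd t" using assms(2) dvd_trans by blast
  have ct: "[c = 2 ^ 3] (mod t)" using assms(2) by (simp add: cong_iff_dvd_diff c_def)
  have "coprime 2 t" using t by simp
  then have "coprime (2 ^ 3) t" by (simp only: coprime_power_left_iff simp_thms)
  then have cop: "coprime t c" using ct cong_imp_coprime cong_sym coprime_commute by blast
  have "jacobi t c = jacobi c t"
  proof (rule jacobi_reciprocity)
    show "t mod 4 = 1 \<or> c mod 4 = 1" using c_mod_8 by presburger
  qed (use assms t odd_c c_pos cop in auto)
  also have "\<dots> = jacobi (2 ^ 3) t" by (rule jacobi_cong[OF ct])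
  also have "\<dots> = jacobi 2 t"
    using jacobi_pm1[OF assms(1) \<open>coprime 2 t\<close>] jacobi_power_left[OF t, of 2 3] by auto
  finally show ?thesis .
qed

section \<open>Parities of the exponents and the root \<open>w\<close> of \<open>u2\<close>\<close>

lemma four_u_power_mod_16: "2 \<le> k \<Longrightarrow> [(4 * u) ^ k * N = 0] (mod 16)"
proof -
  assume "2 \<le> k"
  then have "(4::int) ^ 2 dvd 4 ^ k" by (rule le_imp_power_dvd)
  then show ?thesis by (simp add: cong_0_iff power_mult_distrib)
qed

lemma y_ge_3: "y \<ge> 3" using x_pos x_less_z z_less_y by linarith

lemma u1_power_mod_16: "[u1 ^ x = c ^ z] (mod 16)"
  using four_u_power_mod_16[of y "n ^ (y - z)"] y_ge_3 eqn[symmetric]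
  by (simp add: cong_iff_dvd_diff)

lemma u1_power_mod_8: "[u1 ^ x = c ^ z] (mod 8)"
  using u1_power_mod_16 by (rule cong_dvd_modulus) simp

lemma z_odd_cases:
  assumes "odd z"
  shows "odd x" "[u1 = 5] (mod 8)"
proof -
  have c5: "[c ^ z = 5] (mod 8)" using odd_power_mod_8[OF odd_c assms] c_mod_8 by (simp add: cong_def)
  then have 1: "[u1 ^ x = 5] (mod 8)" using u1_power_mod_8 cong_trans by blast
  show "odd x"
  proof
    assume "even x"
    then have "[u1 ^ x = 1] (mod 8)" using even_power_mod_8[OF odd_u1] by blast
    then show False using 1 by (simp add: cong_def)
  qed
  then show "[u1 = 5] (mod 8)" using 1 odd_power_mod_8[OF odd_u1] cong_trans cong_sym by metis
qed

text \<open>For x odd, u1 and u2 have at p the symbols of n^(y-z) and n^(z-x), so (2/p) = (u1 u2/p)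
  is the symbol of n^(y-x). At a prime where 2 is a nonresidue y - x must be odd.\<close>

lemma x_odd_imp_y_even:
  assumes "odd x"
  shows "even y"
proof (rule ccontr)
  assume y: "odd y"
  obtain p where p: "prime p" "p dvd c" "Legendre 2 p \<noteq> 1" by (rule nonresidue_2_c)
  note q = prime_dvd_c[OF p(1,2)]
  have 1: "Legendre u1 p = Legendre (n ^ (y - z)) p"
    using Legendre_u1_power_c[OF p(1,2)] Legendre_power_odd[OF p(1) q(1) assms] by simp
  have 2: "Legendre u2 p = Legendre (n ^ (z - x)) p"
    using Legendre_u2_power_c[of p] Legendre_power_odd[OF p(1) q(1) assms] by simp
  have "Legendre u1 p * Legendre u2 p = Legendre (n ^ (y - z + (z - x))) p"
    unfolding 1 2 power_add Legendre_mult[OF p(1) q(1)] ..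
  also have "\<dots> = 1" using y assms z_less_y x_less_z q
    by (intro Legendre_power_even[OF p(1)]) auto
  finally show False using Legendre_u1_u2_c[OF p(1,2)] p(3) by simp
qed

text \<open>The common factor 2^b of the exponents in n^(z-x) = u2^x is cancelled, then square roots
  are taken s times. The relation between \<open>w\<close> and \<open>n\<close> is kept because its
  odd exponents give both the same symbols.\<close>

lemma exists_w:
  assumes "multiplicity 2 x \<le> multiplicity 2 (z - x)"
  obtains w s d' x' where "w > 0" "int s = int (multiplicity 2 (z - x)) - int (multiplicity 2 x)"
    "u2 = w ^ 2 ^ s" "w ^ x' = n ^ d'" "odd x'" "odd d'"
proof -
  obtain x' where x': "x = 2 ^ multiplicity 2 x * x'" "odd x'" using two_power_decomposition[OF x_pos] .
  obtain d' where d': "z - x = 2 ^ multiplicity 2 (z - x) * d'" "odd d'"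
    using two_power_decomposition[of "z - x"] x_less_z by auto
  define b s where "b = multiplicity 2 x" and "s = multiplicity 2 (z - x) - b"
  have sb: "multiplicity 2 (z - x) = b + s" using assms by (simp add: b_def s_def)
  have "n ^ (2 ^ (b + s) * d') = u2 ^ (2 ^ b * x')"
    using n_power d'(1) x'(1) unfolding sb b_def[symmetric] by argo
  then have "(n ^ (2 ^ s * d')) ^ 2 ^ b = (u2 ^ x') ^ 2 ^ b"
    by (simp add: power_mult[symmetric] power_add mult_ac)
  then have "n ^ (2 ^ s * d') = u2 ^ x'" using n_gt_1 u2_pos by (simp add: power_eq_iff_eq_base)
  then obtain w where "w > 0" "u2 = w ^ 2 ^ s" "w ^ x' = n ^ d'"
    using power_eq_two_power_root[of n u2 x' s d'] n_gt_1 u2_pos x'(2) by auto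
  then show ?thesis using that[of w s x' d'] x'(2) d'(2) sb b_def by simp
qed

lemma Legendre_w:
  assumes "w ^ x' = n ^ d'" "odd x'" "odd d'" "prime p" "odd p"
  shows "Legendre w p = Legendre n p"
  using Legendre_power_odd[OF assms(4,5,2), of w] Legendre_power_odd[OF assms(4,5,3), of n] assms(1)
  by simp

lemma prime_dvd_u1:
  assumes "prime p" "p dvd u1"
  shows "odd p" "\<not> p dvd 2" "\<not> p dvd u" "\<not> p dvd c" "\<not> p dvd u2" "\<not> p dvd n" "[c = 2 ^ 3] (mod p)"
    "Legendre c p = Legendre 2 p" "Legendre (4 * u) p = Legendre u p"
    "[(4 * u) ^ y * n ^ (y - z) = c ^ z] (mod p)"
proof -
  show o: "odd p" using assms(2) odd_u1 dvd_trans by blast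
  then show 2: "\<not> p dvd 2" using odd_prime_int_gt_2[OF assms(1)] zdvd_imp_le by fastforce
  have 4: "\<not> p dvd 2 ^ k" for k using 2 assms(1) prime_dvd_power by blast
  have a: "p dvd u\<^sup>2 - 4" using assms(2) u1_u2 by (metis dvd_mult2)
  show "\<not> p dvd u"
  proof
    assume "p dvd u"
    then have "p dvd u * u - (u\<^sup>2 - 4)" by (intro dvd_diff[OF _ a]) simp
    then show False using 4[of 2] by (simp add: power2_eq_square)
  qed
  show "\<not> p dvd c" using prime_dvd_c(4)[OF assms(1)] assms(2) by blast
  show "\<not> p dvd u2" using coprime_u1_u2 assms
    using coprime_common_divisor not_prime_unit by blast
  then show "\<not> p dvd n" using assms(1) prime_dvd_n_iff by simp
  show c: "[c = 2 ^ 3] (mod p)" using a by (simp add: cong_iff_dvd_diff c_def)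
  show "Legendre c p = Legendre 2 p"
    using Legendre_cong[OF c] Legendre_power_odd[OF assms(1) o, of 3 2] by simp
  have "Legendre (2\<^sup>2) p = 1" by (rule Legendre_square[OF assms(1) 2])
  then show "Legendre (4 * u) p = Legendre u p" using Legendre_mult[OF assms(1) o, of "2\<^sup>2" u] by simp
  have "p dvd u1 ^ x" using assms(2) x_pos dvd_power dvd_trans by blast
  then have "[c ^ z = (4 * u) ^ y * n ^ (y - z)] (mod p)"
    by (simp add: cong_iff_dvd_diff eqn[symmetric])
  then show "[(4 * u) ^ y * n ^ (y - z) = c ^ z] (mod p)" by (rule cong_sym)
qed

lemma w_dvd: "u2 = w ^ 2 ^ s \<Longrightarrow> w dvd u\<^sup>2 - 4"
proof -
  assume "u2 = w ^ 2 ^ s"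
  then have "w dvd u2" by (simp add: dvd_power)
  then show ?thesis using u1_u2 by (metis dvd_mult)
qed

text \<open>The product u1 v^2 = u^2 - 4 is 5 modulo 8, -4 modulo u and -8 modulo a prime of c; in
  each case the square drops out and u1 alone carries the value.\<close>

lemma u2_square_consequences:
  assumes "u2 = v\<^sup>2"
  shows "[u1 = 5] (mod 8)" "Legendre u1 u = Legendre (-1) u"
    "\<And>p. prime p \<Longrightarrow> p dvd c \<Longrightarrow> Legendre u1 p = Legendre 2 p"
proof -
  have "odd v" using odd_u2 assms by simp
  then have "[u1 * u2 = u1 * 1] (mod 8)" unfolding assms by (intro cong_mult odd_square_mod_8) auto
  then show "[u1 = 5] (mod 8)" using u1_u2_mod_8 by (metis cong_sym cong_trans mult.right_neutral)
  have "\<not> u dvd v"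
  proof
    assume "u dvd v"
    then have "u dvd u1 * u2" by (simp add: assms power2_eq_square)
    then have "u dvd u * u - (u\<^sup>2 - 4)" unfolding u1_u2 by (rule dvd_diff[OF dvd_triv_left])
    then show False using u_not_dvd_4 by (simp add: power2_eq_square)
  qed
  have "Legendre u1 u = Legendre (u1 * v\<^sup>2) u"
    using Legendre_mult[OF prime_u odd_u] Legendre_square[OF prime_u \<open>\<not> u dvd v\<close>] by simp
  also have "\<dots> = Legendre (-1 * 2\<^sup>2) u"
    using u1_u2 unfolding assms by (intro Legendre_cong) (simp add: cong_iff_dvd_diff)
  also have "\<dots> = Legendre (-1) u"
  proof -
    have "\<not> u dvd 2" using u_ge_3 zdvd_imp_le by fastforce
    then have "Legendre (2\<^sup>2) u = 1" by (rule Legendre_square[OF prime_u])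
    then show ?thesis unfolding Legendre_mult[OF prime_u odd_u, of "-1" "2\<^sup>2"] by simp
  qed
  finally show "Legendre u1 u = Legendre (-1) u" .
  fix p assume p: "prime p" "p dvd c"
  have "\<not> p dvd v" using prime_dvd_c(5)[OF p] unfolding assms power2_eq_square by auto
  then show "Legendre u1 p = Legendre 2 p" 
    using Legendre_u1_u2_c[OF p] Legendre_square[OF p(1)] by (simp add: assms)
qed

section \<open>The case of odd \<open>z\<close>\<close>

lemma conclusion_z_odd:
  assumes "odd z"
  shows "[u1 = 5] (mod 8) \<and>
      (\<exists>(w :: int) (s :: nat). w > 0 \<and>
         int s = int (multiplicity 2 (z - x)) - int (multiplicity 2 x) \<and>
         u2 = w ^ (2 ^ s) \<and>
         ((([w = 3] (mod 8) \<or> [w = -3] (mod 8)) \<and>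
           odd x \<and> odd z \<and> multiplicity 2 y \<ge> 1 \<and>
           [u = 1] (mod 4) \<and>
           (\<forall>p. prime p \<and> p dvd u\<^sup>2 + 4 \<longrightarrow> Legendre u1 p = Legendre w p) \<and>
           (\<forall>p. prime p \<and> p dvd u1 \<longrightarrow> Legendre w p = Legendre (u\<^sup>2 + 4) p))))"
proof -
  note x = z_odd_cases(1)[OF assms]
  have y: "even y" using x_odd_imp_y_even[OF x] .
  have m0: "multiplicity 2 x = 0" using x by (simp add: not_dvd_imp_multiplicity_0)
  then have "multiplicity 2 x \<le> multiplicity 2 (z - x)" by simp
  then obtain w s d' x' where w: "w > 0" "int s = int (multiplicity 2 (z - x)) - int (multiplicity 2 x)"
    "u2 = w ^ 2 ^ s" "w ^ x' = n ^ d'" "odd x'" "odd d'" by (rule exists_w)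
  have "even (z - x)" "z - x \<noteq> 0" using x assms x_less_z by auto
  then have "multiplicity 2 (z - x) > 0" by (simp add: multiplicity_gt_zero_iff)
  then have "s > 0" using w(2) m0 by simp
  then obtain s' where s': "s = Suc s'" using gr0_implies_Suc by blast
  have u2: "u2 = (w ^ 2 ^ s')\<^sup>2" by (simp add: w(3) s' power_mult[symmetric] mult.commute)
  note sq = u2_square_consequences[OF u2]
  have yz: "odd (y - z)" using y assms z_less_y by simp
  have u1w: "Legendre u1 p = Legendre w p" if p: "prime p" "p dvd c" for p
  proof -
    note q = prime_dvd_c[OF p]
    show ?thesis using Legendre_u1_power_c[OF p] Legendre_power_odd[OF p(1) q(1) x] 
        Legendre_power_odd[OF p(1) q(1) yz] Legendre_w[OF w(4-6) p(1) q(1)] by simp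
  qed
  \<comment> \<open>u2 is a square since s > 0, so at every prime of c the symbol of w is that of u1
    and hence that of 2. The value (2/w) = (w/c) = -1 fixes w modulo 8.\<close>
  have "jacobi w c = jacobi 2 c" using u1w sq(3) by (intro jacobi_transfer) auto
  then have "jacobi 2 w = -1" using jacobi_2_c jacobi_divisor_c[OF w(1) w_dvd[OF w(3)]] by simp
  moreover have "odd w" using odd_u2 w(3) by simp
  ultimately have "w mod 8 = 3 \<or> w mod 8 = 5" 
    using jacobi_2[OF w(1)] odd_mod_8_cases[of w] by auto
  then have w8: "[w = 3] (mod 8) \<or> [w = -3] (mod 8)" by (auto simp: cong_def)
  \<comment> \<open>Modulo u the equation says u1^x = 4^z, a square. With x odd u1 is a square
    modulo u, and (u1/u) = (-1/u) turns this into u = 1 (mod 4).\<close>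
  have "[u1 ^ x = c ^ z] (mod u)" 
  proof -
    have "u dvd (4 * u) ^ y" using y_ge_3 by (simp add: power_mult_distrib dvd_power)
    then have "[c ^ z = u1 ^ x] (mod u)" by (simp add: cong_iff_dvd_diff eqn[symmetric])
    then show ?thesis by (rule cong_sym)
  qed
  moreover have "[c ^ z = (2 ^ z)\<^sup>2] (mod u)"
  proof -
    have "[c ^ z = (2\<^sup>2) ^ z] (mod u)" by (intro cong_pow) (simp add: c_def cong_iff_dvd_diff power2_eq_square)
    moreover have "((2::int)\<^sup>2) ^ z = (2 ^ z)\<^sup>2" by (simp only: power_mult[symmetric] mult.commute)
    ultimately show ?thesis by metis
  qed
  ultimately have "[u1 ^ x = (2 ^ z)\<^sup>2] (mod u)" by (rule cong_trans)
  moreover have "\<not> u dvd 2 ^ z"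
  proof
    assume "u dvd 2 ^ z"
    then have "u dvd 2" using prime_u prime_dvd_power by blast
    then show False using u_ge_3 zdvd_imp_le by fastforce
  qed
  ultimately have "Legendre (u1 ^ x) u = 1" 
    using Legendre_square[OF prime_u] Legendre_cong by metis
  then have "Legendre (-1) u = 1" using Legendre_power_odd[OF prime_u odd_u x] sq(2) by simp
  then have u4: "[u = 1] (mod 4)" using Legendre_minus_1[OF prime_u odd_u] 
    by (simp add: cong_def split: if_splits)
  have wc: "Legendre w p = Legendre c p" if p: "prime p" "p dvd u1" for p
  proof -
    note q = prime_dvd_u1[OF p]
    have "Legendre ((4 * u) ^ y) p = 1"
    proof (rule Legendre_power_even[OF p(1) q(1) y])
      have "\<not> p dvd 2 ^ 2" using q(2) p(1) prime_dvd_power by blast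
      then show "\<not> p dvd 4 * u" using q(3) p(1) by (simp add: prime_dvd_mult_iff)
    qed
    then have "Legendre (n ^ (y - z)) p = Legendre (c ^ z) p"
      using Legendre_cong[OF q(10)] Legendre_mult[OF p(1) q(1)] by simp
    then show ?thesis using Legendre_power_odd[OF p(1) q(1) yz] Legendre_power_odd[OF p(1) q(1) assms]
      Legendre_w[OF w(4-6) p(1) q(1)] by simp
  qed
  have "multiplicity 2 y \<ge> 1" using y y_ge_3 multiplicity_gt_zero_iff[of y 2] by simp
  then show ?thesis
    by (intro conjI exI[of _ w] exI[of _ s] allI impI)
      (use sq(1) w w8 x assms u4 u1w wc in \<open>simp_all add: c_def\<close>)
qed

section \<open>The case of odd \<open>x\<close> and even \<open>z\<close>\<close>

lemma coprime_c: "coprime (c ^ i) ((4 * u) ^ j * n ^ k)"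
proof -
  have *: "coprime c t" if "\<And>p. prime p \<Longrightarrow> p dvd c \<Longrightarrow> \<not> p dvd t" for t
  proof (rule coprimeI)
    fix d assume d: "d dvd c" "d dvd t"
    show "is_unit d"
    proof (rule ccontr)
      assume "\<not> is_unit d"
      moreover have "d \<noteq> 0" using d(1) c_pos by auto
      ultimately obtain p where "prime p" "p dvd d" using prime_divisor_exists by blast
      then show False using that d dvd_trans by blast
    qed
  qed
  have "coprime c 2" "coprime c u" "coprime c n" using prime_dvd_c by (blast intro: *)+
  moreover have "(4::int) * u = 2 * (2 * u)" by simp
  ultimately show ?thesis 
    by (simp only: coprime_power_left_iff coprime_power_right_iff coprime_mult_right_iff) simp
qed

text \<open>With G = c^z' and H = (4u)^y' n^(y'-z') the equation reads G^(2^j) - H^(2^j) = u1^x, so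
  the factor G - H is an x-th power. Modulo 8 the term H vanishes.\<close>

lemma two_power_root:
  assumes "y = 2 ^ j * y'" "z = 2 ^ j * z'"
  obtains r where "r > 0" "c ^ z' - (4 * u) ^ y' * n ^ (y' - z') = r ^ x" 
    "odd r" "[r ^ x = c ^ z'] (mod 8)"
proof -
  let ?G = "c ^ z'" and ?H = "(4 * u) ^ y' * n ^ (y' - z')"
  have yz: "z' < y'" "z' > 0" using assms z_less_y x_less_z by (auto intro: Nat.gr0I)
  have "y - z = (y' - z') * 2 ^ j" by (simp add: assms algebra_simps)
  then have eq: "?G ^ 2 ^ j - ?H ^ 2 ^ j = u1 ^ x"
    using eqn by (simp add: assms power_mult_distrib power_mult[symmetric] mult.commute)
  moreover have "u1 ^ x > 0" using u1_pos by simp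
  ultimately have "?H ^ 2 ^ j < ?G ^ 2 ^ j" by linarith
  then have HG: "?H < ?G" using c_pos power_less_imp_less_base[of ?H "2 ^ j" ?G] by simp
  have H0: "0 \<le> ?H" using u_ge_3 n_gt_1 by simp
  have "even ?H" using yz by simp
  then obtain r where r: "r > 0" "?G - ?H = r ^ x"
    using power_two_power_diff_nth_power[OF H0 HG coprime_c _ _ eq u1_pos x_pos] odd_c by auto
  have "odd (?G - ?H)" using odd_c \<open>even ?H\<close> by simp
  then have "odd r" unfolding r(2) using x_pos by simp
  have "2 \<le> y'" using yz by linarith
  then have "[?H = 0] (mod 16)" by (rule four_u_power_mod_16)
  then have "[?H = 0] (mod 8)" by (rule cong_dvd_modulus) simp
  then have "[?G - ?H = ?G - 0] (mod 8)" by (intro cong_diff cong_refl)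
  then show ?thesis using that[OF r \<open>odd r\<close>] r(2) by simp
qed

lemma Legendre_two_power_root:
  assumes "c ^ z' - (4 * u) ^ y' * n ^ k = r ^ x" "z' > 0" "prime p" "p dvd c"
  shows "Legendre (r ^ x) p = Legendre (n ^ k) p"
proof (rule Legendre_c[OF assms(3,4)])
  have "p dvd c ^ z'" using assms by (metis dvd_power dvd_trans)
  then show "[r ^ x = - ((4 * u) ^ y' * n ^ k)] (mod p)"
    by (simp add: cong_iff_dvd_diff assms(1)[symmetric])
qed

text \<open>The parity of \<open>yh\<close> is found by computing (2/t1) twice. At primes of c one
  has (u1/p) = 1 and (n/p) = (u2/p) = (2/p), so t1 has the symbol of 2^(yh - zh) and (2/t1) = (t1/c)
  = (-1)^(yh - zh). On the other hand t1 = c^zh (mod 8) gives (2/t1) = (-1)^zh.\<close>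

lemma x_odd_z_even_factors:
  assumes "odd x" "z = 2 * zh"
  obtains yh t1 t2 where "y = 2 * yh" "even yh" "zh < yh" "t1 > 0" "t2 > 0" "coprime t1 t2" "u1 = t1 * t2"
    "c ^ zh - (4 * u) ^ yh * n ^ (yh - zh) = t1 ^ x" "c ^ zh + (4 * u) ^ yh * n ^ (yh - zh) = t2 ^ x"
    "[t1 = c ^ zh] (mod 8)" "[t2 = c ^ zh] (mod 8)"
proof -
  obtain yh where yh: "y = 2 * yh" using x_odd_imp_y_even[OF assms(1)] by blast
  have lt: "zh < yh" "zh > 0" using z_less_y x_less_z assms yh by auto
  let ?G = "c ^ zh" and ?H = "(4 * u) ^ yh * n ^ (yh - zh)"
  have "y - z = (yh - zh) * 2" by (simp add: assms yh algebra_simps)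
  then have eq: "?G\<^sup>2 - ?H\<^sup>2 = u1 ^ x"
    using eqn by (simp add: assms yh power_mult_distrib power_mult[symmetric] mult.commute)
  moreover have "u1 ^ x > 0" using u1_pos by simp
  ultimately have "?H\<^sup>2 < ?G\<^sup>2" by linarith
  then have HG: "?H < ?G" using c_pos power_less_imp_less_base[of ?H 2 ?G] by simp
  have H0: "0 \<le> ?H" using u_ge_3 n_gt_1 by simp
  have "odd (?G + ?H)" using odd_c lt by simp
  then obtain t1 t2 where t: "t1 > 0" "t2 > 0" "?G - ?H = t1 ^ x" "?G + ?H = t2 ^ x" "coprime t1 t2" "u1 = t1 * t2"
    using square_diff_nth_power[OF H0 HG coprime_c _ eq u1_pos x_pos] by metis
  have odd_t: "odd t1" "odd t2" using odd_u1 t(6) by auto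
  have "2 \<le> yh" using lt by linarith
  then have "[?H = 0] (mod 16)" by (rule four_u_power_mod_16)
  then have H8: "[?H = 0] (mod 8)" by (rule cong_dvd_modulus) simp
  have "[?G - ?H = ?G - 0] (mod 8)" by (intro cong_diff cong_refl H8)
  then have t1: "[t1 = ?G] (mod 8)" using odd_power_mod_8[OF odd_t(1) assms(1)] t(3)
    by (metis cong_sym cong_trans diff_zero)
  have "[?G + ?H = ?G + 0] (mod 8)" by (intro cong_add cong_refl H8)
  then have t2: "[t2 = ?G] (mod 8)" using odd_power_mod_8[OF odd_t(2) assms(1)] t(4)
    by (metis cong_sym cong_trans add.right_neutral)
  have "t1 dvd u\<^sup>2 - 4" using u1_u2 t(6) by (metis dvd_triv_left dvd_mult2)
  then have jac: "jacobi t1 c = jacobi 2 t1" using jacobi_divisor_c t(1) by blast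
  have leg: "Legendre t1 p = (if even (yh - zh) then 1 else Legendre 2 p)" if p: "prime p" "p dvd c" for p
  proof -
    note q = prime_dvd_c[OF p]
    have 1: "Legendre t1 p = Legendre (n ^ (yh - zh)) p"
      using Legendre_two_power_root[OF t(3) lt(2) p] Legendre_power_odd[OF p(1) q(1) assms(1)] by simp
    have "odd (z - x)" using assms x_less_z by simp
    then have n2: "Legendre u2 p = Legendre n p"
      using Legendre_u2_power_c[of p] Legendre_power_odd[OF p(1) q(1)] assms(1) by simp
    have "even (y - z)" by (simp add: yh assms)
    then have "Legendre u1 p = 1"
      using Legendre_u1_power_c[OF p] Legendre_power_odd[OF p(1) q(1) assms(1)]
        Legendre_power_even[OF p(1) q(1) _ q(6)] by simp
    then have "Legendre n p = Legendre 2 p" using Legendre_u1_u2_c[OF p] n2 by simp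
    then show ?thesis using 1 Legendre_power_odd[OF p(1) q(1)] Legendre_power_even[OF p(1) q(1) _ q(6)]
      by simp
  qed
  have j: "jacobi 2 t1 = (if even (yh - zh) then 1 else -1)"
  proof (cases "even (yh - zh)")
    case True
    then show ?thesis using jacobi_eq_1[of c t1] leg jac by simp
  next
    case False
    then show ?thesis using jacobi_transfer[of c t1 2] leg jac jacobi_2_c by simp
  qed
  have "even yh"
  proof (cases "even zh")
    case True
    then have "[t1 = 1] (mod 8)" using t1 even_power_mod_8[OF odd_c] cong_trans by blast
    then have "jacobi 2 t1 = 1" using jacobi_2[OF t(1) odd_t(1)] by (simp add: cong_def)
    then show ?thesis using j lt True by (auto split: if_splits)
  next
    case False
    then have "[t1 = c] (mod 8)" using t1 odd_power_mod_8[OF odd_c] cong_trans by blast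
    then have "jacobi 2 t1 = -1" using jacobi_2[OF t(1) odd_t(1)] c_mod_8 by (simp add: cong_def)
    then show ?thesis using j lt False by (auto split: if_splits)
  qed
  then show ?thesis using that[OF yh _ lt(1) t(1,2,5,6,3,4) t1 t2] by simp
qed

text \<open>If zh = 2q, then yh is even as well, and t1^x is again a difference of coprime squares.
  Its factors are the x-th powers of r1 and r2 on which the size argument runs.\<close>

lemma x_odd_imp_not_4_dvd_z:
  assumes "odd x" "z = 2 * zh"
  shows "odd zh"
proof (rule ccontr)
  assume "\<not> odd zh"
  then obtain q where q: "zh = 2 * q" by blast
  obtain yh t1 t2 where yh: "y = 2 * yh" "even yh" "zh < yh" "t1 > 0"
    and t1: "c ^ zh - (4 * u) ^ yh * n ^ (yh - zh) = t1 ^ x"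
    using x_odd_z_even_factors[OF assms] by metis
  obtain Y where Y: "yh = 2 * Y" using yh(2) by blast
  have qY: "q < Y" "q > 0" using yh(3) q Y assms(2) x_less_z by auto
  let ?G = "c ^ q" and ?H = "(4 * u) ^ Y * n ^ (Y - q)"
  have "yh - zh = (Y - q) * 2" by (simp add: q Y algebra_simps)
  then have eq: "?G\<^sup>2 - ?H\<^sup>2 = t1 ^ x"
    using t1 by (simp add: q Y power_mult_distrib power_mult[symmetric] mult.commute)
  moreover have "t1 ^ x > 0" using yh by simp
  ultimately have "?H\<^sup>2 < ?G\<^sup>2" by linarith
  then have HG: "?H < ?G" using c_pos power_less_imp_less_base[of ?H 2 ?G] by simp
  have H0: "0 \<le> ?H" using u_ge_3 n_gt_1 by simp
  have "odd (?G + ?H)" using odd_c qY by simp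
  then obtain r1 r2 where r: "r1 > 0" "r2 > 0" "?G - ?H = r1 ^ x" "?G + ?H = r2 ^ x"
    using square_diff_nth_power[OF H0 HG coprime_c _ eq yh(4) x_pos] by metis
  have "y - z = (Y - q) * 4" "y = Y * 4" "z = q * 4" using yh q Y assms by auto
  then have "u1 ^ x = ?G ^ 4 - ?H ^ 4"
    using eqn by (simp add: power_mult_distrib power_mult)
  then show False
    using no_solution_exponents_div_4[of u x q Y u1 u2 r1 r2 n] u_ge_3 odd_u assms q x_less_z qY
      u1_pos u2_pos r n_gt_1 u1_u2 n_power by (simp add: c_def)
qed

lemma conclusion_x_odd_z_even:
  assumes "odd x" "even z"
  shows "multiplicity 2 (u1 - 1) = 3 \<and>
      odd x \<and> multiplicity 2 y \<ge> 2 \<and> multiplicity 2 z = 1 \<and>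
      (\<exists>t1 t2 :: int. t1 > 1 \<and> t2 > 1 \<and> coprime t1 t2 \<and> u1 = t1 * t2 \<and>
         [t1 = 5] (mod 8) \<and> [t2 = 5] (mod 8) \<and>
         t2 ^ x + t1 ^ x = 2 * (u\<^sup>2 + 4) ^ (z div 2) \<and>
         t2 ^ x - t1 ^ x = 2 ^ (y + 1) * u ^ (y div 2) * n ^ ((y - z) div 2))"
proof -
  obtain zh where zh: "z = 2 * zh" using assms(2) by blast
  have "odd zh" using x_odd_imp_not_4_dvd_z[OF assms(1) zh] .
  obtain yh t1 t2 where *: "y = 2 * yh" "even yh" "zh < yh" "t1 > 0" "t2 > 0" "coprime t1 t2" "u1 = t1 * t2"
    "c ^ zh - (4 * u) ^ yh * n ^ (yh - zh) = t1 ^ x" "c ^ zh + (4 * u) ^ yh * n ^ (yh - zh) = t2 ^ x"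
    "[t1 = c ^ zh] (mod 8)" "[t2 = c ^ zh] (mod 8)" using x_odd_z_even_factors[OF assms(1) zh] .
  have "[c ^ zh = c] (mod 8)" using odd_power_mod_8[OF odd_c \<open>odd zh\<close>] .
  then have c5: "[c ^ zh = 5] (mod 8)" using c_mod_8 by (simp add: cong_def)
  then have t5: "[t1 = 5] (mod 8)" "[t2 = 5] (mod 8)" using *(10,11) cong_trans by blast+
  have gt1: "t1 > 1" "t2 > 1" using t5 *(4,5) by (cases "t1 = 1"; cases "t2 = 1"; simp add: cong_def)+
  have "[u1 = 5 * 5] (mod 8)" unfolding *(7) using t5 by (rule cong_mult)
  then have u18: "u1 mod 8 = 1" by (simp add: cong_def)
  \<comment> \<open>The residue of u1 modulo 16 decides the valuation of u1 - 1. There c^2 = 9 and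
    zh odd give c^z = 9, while u1 = 1 (mod 8) gives u1^2 = 1 and so u1^x = u1; hence u1 = 9 (mod
    16).\<close>
  have sq9: "[(t\<^sup>2) ^ k * s = 9 ^ k * s] (mod 16)" if "t mod 8 = 5" for t s :: int and k
  proof -
    obtain m where "t = 8 * m + 5" using \<open>t mod 8 = 5\<close> by (metis mult_div_mod_eq)
    then have "t\<^sup>2 - 9 = 16 * (4 * m\<^sup>2 + 5 * m + 1)" by (simp add: power2_eq_square algebra_simps)
    then have "[t\<^sup>2 = 9] (mod 16)" by (simp add: cong_iff_dvd_diff)
    then show ?thesis by (intro cong_mult cong_pow cong_refl)
  qed
  have "[c ^ z = 9] (mod 16)"
  proof -
    obtain k where k: "zh = 2 * k + 1" using \<open>odd zh\<close> by (rule oddE)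
    have "[(c\<^sup>2) ^ zh * 1 = 9 ^ zh * 1] (mod 16)" using sq9 c_mod_8 by blast
    moreover have "[((9::int)\<^sup>2) ^ k * 9 = 1 ^ k * 9] (mod 16)" 
      by (intro cong_mult cong_pow cong_refl) (simp add: cong_def)
    moreover have "(9::int) ^ zh = (9\<^sup>2) ^ k * 9" by (simp only: k power_add power_mult power_one_right)
    ultimately show ?thesis by (simp add: zh power_mult) (metis cong_trans)
  qed
  then have u1x: "[u1 ^ x = 9] (mod 16)" using u1_power_mod_16 cong_trans by blast
  have "[u1 ^ x = u1] (mod 16)"
  proof -
    obtain k where k: "x = 2 * k + 1" using assms(1) by (rule oddE)
    obtain m where "u1 = 8 * m + 1" using u18 by (metis mult_div_mod_eq)
    then have "u1\<^sup>2 - 1 = 16 * (4 * m\<^sup>2 + m)" by (simp add: power2_eq_square algebra_simps)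
    then have "[u1\<^sup>2 = 1] (mod 16)" by (simp add: cong_iff_dvd_diff)
    then have "[(u1\<^sup>2) ^ k * u1 = 1 ^ k * u1] (mod 16)" by (intro cong_mult cong_pow cong_refl)
    then show ?thesis by (simp only: k power_add power_mult power_one_right power_one mult_1)
  qed
  then have "u1 mod 16 = 9" using u1x by (simp add: cong_def)
  then obtain m where "u1 = 16 * m + 9" by (metis mult_div_mod_eq)
  then have "2 ^ 3 dvd u1 - 1" "\<not> 2 ^ Suc 3 dvd u1 - 1" by (simp_all, presburger+)
  then have m3: "multiplicity 2 (u1 - 1) = 3" by (rule multiplicity_eqI)
  have mz: "multiplicity 2 z = 1" using multiplicity_2_power_mult[OF \<open>odd zh\<close>, of 1] zh by simp
  obtain Y where "yh = 2 * Y" using *(2) by blast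
  then have "2 ^ 2 dvd y" using *(1) by simp
  then have my: "multiplicity 2 y \<ge> 2" using y_ge_3 by (intro multiplicity_geI) auto
  have s: "t2 ^ x + t1 ^ x = 2 * (u\<^sup>2 + 4) ^ (z div 2)"
    unfolding *(8,9)[symmetric] by (simp add: zh c_def)
  have "(y - z) div 2 = yh - zh" using *(1) zh by simp
  then have d: "t2 ^ x - t1 ^ x = 2 ^ (y + 1) * u ^ (y div 2) * n ^ ((y - z) div 2)"
    unfolding *(8,9)[symmetric] by (simp add: *(1) power_mult_distrib power_mult)
  show ?thesis using m3 assms(1) my mz gt1 *(6,7) t5 s d by blast
qed

section \<open>The case of even \<open>x\<close> and \<open>z\<close>\<close>

text \<open>If y had as many factors 2 as z, removing them would give r^x = c^z' = 5 (mod 8),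
  impossible for even x. So only the factors 2 of y are removed; the exponent of n is then odd, and
  (n/p) = (r/p)^x is an even power.\<close>

lemma Legendre_n_c_even:
  assumes "even x" "even z"
  shows "multiplicity 2 y < multiplicity 2 z"
    "\<And>p. prime p \<Longrightarrow> p dvd c \<Longrightarrow> Legendre n p = 1"
proof -
  obtain z' where z': "z = 2 ^ multiplicity 2 z * z'" "odd z'"
    using two_power_decomposition[of z] x_less_z by auto
  show lt: "multiplicity 2 y < multiplicity 2 z"
  proof (rule ccontr)
    assume "\<not> multiplicity 2 y < multiplicity 2 z"
    then have "2 ^ multiplicity 2 z dvd y" by (intro multiplicity_dvd') simp
    then obtain y' where "y = 2 ^ multiplicity 2 z * y'" by blast
    then obtain r where r: "odd r" "[r ^ x = c ^ z'] (mod 8)" using two_power_root z'(1) by metis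
    have "[c ^ z' = c] (mod 8)" by (rule odd_power_mod_8[OF odd_c z'(2)])
    moreover have "[r ^ x = 1] (mod 8)" by (rule even_power_mod_8[OF r(1) assms(1)])
    ultimately show False using r(2) c_mod_8 by (simp add: cong_def)
  qed
  define j where "j = multiplicity 2 y"
  obtain y' where y': "y = 2 ^ j * y'" "odd y'"
    using two_power_decomposition[of y] y_ge_3 j_def by auto
  have "2 ^ Suc j dvd z" using lt by (intro multiplicity_dvd') (simp add: j_def)
  then obtain z'' where z'': "z = 2 ^ j * (2 * z'')" by (auto simp: mult.assoc mult.left_commute)
  then obtain r where r: "r > 0" "c ^ (2 * z'') - (4 * u) ^ y' * n ^ (y' - 2 * z'') = r ^ x"
    using two_power_root y'(1) by metis
  have "2 * z'' < y'" using z_less_y unfolding y'(1) z'' by simp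
  then have "odd (y' - 2 * z'')" using y'(2) by simp
  have "2 * z'' > 0" using z'' x_less_z by (auto intro: Nat.gr0I)
  fix p assume p: "prime p" "p dvd c"
  note q = prime_dvd_c[OF p]
  have "Legendre r p ^ x = Legendre n p"
    using Legendre_two_power_root[OF r(2) \<open>2 * z'' > 0\<close> p] Legendre_power[OF p(1) q(1), of r x]
      Legendre_power_odd[OF p(1) q(1) \<open>odd (y' - 2 * z'')\<close>] by simp
  moreover have "Legendre r p ^ x \<noteq> -1" using assms(1) zero_le_even_power[of x "Legendre r p"] by linarith
  ultimately show "Legendre n p = 1" using Legendre_pm1[OF q(6)] by auto
qed

text \<open>c^z - u1^x is divisible by 2^(2y). If the valuations differed, removing 2^(j+1), the
  smaller power of 2, would give bases with squares differing by 8 modulo 16, and the difference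
  would have only j + 3 factors 2.\<close>

lemma exponents_even_same_valuation:
  assumes "even x" "even z"
  shows "multiplicity 2 x = multiplicity 2 z"
proof -
  obtain x' where x': "x = 2 ^ multiplicity 2 x * x'" "odd x'" using two_power_decomposition[OF x_pos] .
  obtain z' where z': "z = 2 ^ multiplicity 2 z * z'" "odd z'"
    using two_power_decomposition[of z] x_less_z by auto
  have pow: "2 ^ (2 * y) dvd c ^ z - u1 ^ x"
    by (simp add: eqn[symmetric] power_mult_distrib power_mult)
  have contra: False
    if "(A\<^sup>2 - B\<^sup>2) mod 16 = 8" "odd A" "odd B" "A ^ 2 ^ Suc j = c ^ z" "B ^ 2 ^ Suc j = u1 ^ x"
      "2 ^ Suc j dvd z" for A B j
  proof -
    have "2 * y \<le> j + 3" using two_power_diff_valuation[OF that(2,3,1)] pow that(4,5) by metis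
    moreover have "2 ^ Suc j \<le> z" using that(6) x_less_z by (intro dvd_imp_le) auto
    moreover have "Suc j < 2 ^ Suc j" by (rule less_exp)
    ultimately show False using z_less_y y_ge_3 by linarith
  qed
  have mod16: "(A\<^sup>2 - B\<^sup>2) mod 16 = 8" 
    if "A mod 8 = 1 \<and> (B mod 8 = 3 \<or> B mod 8 = 5) \<or> A mod 8 = 5 \<and> B mod 8 = 1" for A B :: int
  proof -
    have sq: "(8 * k + i)\<^sup>2 mod 16 = (i * i) mod 16" for k i :: int
    proof -
      have "(8 * k + i)\<^sup>2 = i * i + 16 * (4 * k\<^sup>2 + k * i)" by (simp add: power2_eq_square algebra_simps)
      then show ?thesis by (simp only: mod_mult_self2)
    qed
    have "A\<^sup>2 mod 16 = ((A mod 8) * (A mod 8)) mod 16" "B\<^sup>2 mod 16 = ((B mod 8) * (B mod 8)) mod 16"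
      using sq[of "A div 8" "A mod 8"] sq[of "B div 8" "B mod 8"] by simp_all
    then have "A\<^sup>2 mod 16 = 1 \<and> B\<^sup>2 mod 16 = 9 \<or> A\<^sup>2 mod 16 = 9 \<and> B\<^sup>2 mod 16 = 1"
      using that by auto
    then show ?thesis by (subst mod_diff_eq[symmetric]) auto
  qed
  have mx: "multiplicity 2 x > 0" and mz: "multiplicity 2 z > 0"
    using assms x_pos x_less_z by (auto simp: multiplicity_gt_zero_iff)
  show ?thesis
  proof (rule linorder_cases)
    assume lt: "multiplicity 2 x < multiplicity 2 z"
    define j where "j = multiplicity 2 x - 1"
    have j: "multiplicity 2 x = Suc j" using mx by (simp add: j_def)
    have "2 ^ Suc (Suc j) dvd z" using lt j by (intro multiplicity_dvd') simp
    then obtain k where k: "z = 2 ^ Suc j * (2 * k)" by (auto simp: mult.assoc mult.left_commute)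
    have xj: "x = 2 ^ Suc j * x'" using x'(1) j by simp
    have "z - x = 2 ^ Suc j * (2 * k - x')" by (simp only: k xj right_diff_distrib')
    then have "(n ^ (2 * k - x')) ^ 2 ^ Suc j = (u2 ^ x') ^ 2 ^ Suc j"
      using n_power xj by (simp only: power_mult[symmetric] mult.commute)
    then have nu: "n ^ (2 * k - x') = u2 ^ x'" using n_gt_1 u2_pos by (simp add: power_eq_iff_eq_base)
    have "x' < 2 * k" using x_less_z unfolding k xj by simp
    then have odd_k: "odd (2 * k - x')" using x'(2) by simp
    \<comment> \<open>After cancelling 2^(j+1) the exponents of n and u2 are odd, so u2 has the
      symbols of n, all 1 at primes of c. Then u2 is 1 or 7 modulo 8, and u1 u2 = 5 leaves 5 or 3
      for u1.\<close>
    have "jacobi u2 c = 1"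
    proof (rule jacobi_eq_1)
      fix p assume p: "prime p" "p dvd c"
      note q = prime_dvd_c[OF p]
      show "Legendre u2 p = 1"
        using nu Legendre_power_odd[OF p(1) q(1) odd_k, of n] Legendre_power_odd[OF p(1) q(1) x'(2), of u2]
          Legendre_n_c_even(2)[OF assms p] by simp
    qed
    moreover have "u2 dvd u\<^sup>2 - 4" using u1_u2 by (metis dvd_triv_right)
    ultimately have "jacobi 2 u2 = 1" using jacobi_divisor_c[OF u2_pos] by simp
    then have "u2 mod 8 = 1 \<or> u2 mod 8 = 7" using jacobi_2[OF u2_pos odd_u2] by (auto split: if_splits)
    moreover have "((u1 mod 8) * (u2 mod 8)) mod 8 = 5" using u1_u2_mod_8 by (simp add: cong_def mod_mult_eq)
    ultimately have u1: "u1 mod 8 = 3 \<or> u1 mod 8 = 5" using odd_mod_8_cases[OF odd_u1] by auto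
    have "[u1 ^ x' = u1] (mod 8)" by (rule odd_power_mod_8[OF odd_u1 x'(2)])
    then have "(u1 ^ x') mod 8 = 3 \<or> (u1 ^ x') mod 8 = 5" using u1 by (simp add: cong_def)
    moreover have "(c ^ (2 * k)) mod 8 = 1" using even_power_mod_8[OF odd_c, of "2 * k"] by (simp add: cong_def)
    ultimately have "((c ^ (2 * k))\<^sup>2 - (u1 ^ x')\<^sup>2) mod 16 = 8" using mod16 by blast
    then have False
    proof (rule contra)
      show "(c ^ (2 * k)) ^ 2 ^ Suc j = c ^ z" unfolding power_mult[symmetric] k by (simp only: ac_simps)
      show "(u1 ^ x') ^ 2 ^ Suc j = u1 ^ x" unfolding power_mult[symmetric] xj by (simp only: ac_simps)
    qed (use odd_c odd_u1 k in auto)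
    then show ?thesis ..
  next
    assume lt: "multiplicity 2 z < multiplicity 2 x"
    define j where "j = multiplicity 2 z - 1"
    have j: "multiplicity 2 z = Suc j" using mz by (simp add: j_def)
    have "2 ^ Suc (Suc j) dvd x" using lt j by (intro multiplicity_dvd') simp
    then obtain k where k: "x = 2 ^ Suc j * (2 * k)" by (auto simp: mult.assoc mult.left_commute)
    have zj: "z = 2 ^ Suc j * z'" using z'(1) j by simp
    have "[c ^ z' = c] (mod 8)" by (rule odd_power_mod_8[OF odd_c z'(2)])
    then have "(c ^ z') mod 8 = 5" using c_mod_8 by (simp add: cong_def)
    moreover have "(u1 ^ (2 * k)) mod 8 = 1" using even_power_mod_8[OF odd_u1, of "2 * k"] by (simp add: cong_def)
    ultimately have "((c ^ z')\<^sup>2 - (u1 ^ (2 * k))\<^sup>2) mod 16 = 8" using mod16 by blast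
    then have False
    proof (rule contra)
      show "(c ^ z') ^ 2 ^ Suc j = c ^ z" unfolding power_mult[symmetric] zj by (simp only: ac_simps)
      show "(u1 ^ (2 * k)) ^ 2 ^ Suc j = u1 ^ x" unfolding power_mult[symmetric] k by (simp only: ac_simps)
    qed (use odd_c odd_u1 zj in auto)
    then show ?thesis ..
  qed
qed

lemma conclusion_x_z_even:
  assumes "even x" "even z"
  shows "[u1 = 5] (mod 8) \<and>
      (\<exists>(w :: int) (s :: nat). w > 0 \<and>
         int s = int (multiplicity 2 (z - x)) - int (multiplicity 2 x) \<and>
         u2 = w ^ (2 ^ s) \<and>
          (([w = 1] (mod 8) \<or> [w = -1] (mod 8)) \<and>
           (\<exists>\<beta> \<ge> 1. multiplicity 2 x = \<beta> \<and> multiplicity 2 z = \<beta>) \<and> odd y \<and>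
           ([u = 3] (mod 8) \<or> [u = -3] (mod 8)) \<and>
           (\<forall>p. prime p \<and> p dvd u\<^sup>2 + 4 \<longrightarrow> Legendre w p = 1) \<and>
           (\<forall>p. prime p \<and> p dvd u1 \<longrightarrow> Legendre w p = Legendre u p) \<and>
           ([u = 3] (mod 8) \<longrightarrow> \<not> is_square w)))"
proof -
  have mxz: "multiplicity 2 x = multiplicity 2 z" by (rule exponents_even_same_valuation[OF assms])
  have mx: "multiplicity 2 x > 0" using assms x_pos by (auto simp: multiplicity_gt_zero_iff)
  define j where "j = multiplicity 2 x - 1"
  have j: "multiplicity 2 x = Suc j" using mx by (simp add: j_def)
  obtain x' where x': "x = 2 ^ Suc j * x'" "odd x'" using two_power_decomposition[OF x_pos] j by metis
  obtain z' where z': "z = 2 ^ Suc j * z'" "odd z'"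
    using two_power_decomposition[of z] x_less_z j mxz by (metis gr_implies_not0 neq0_conv)
  have "z - x = 2 ^ Suc j * (z' - x')" by (simp only: x' z' right_diff_distrib')
  moreover have "even (z' - x')" using x'(2) z'(2) by simp
  ultimately have "2 ^ Suc (Suc j) dvd z - x" by (auto simp: mult.assoc mult.left_commute)
  then have mzx: "Suc (Suc j) \<le> multiplicity 2 (z - x)"
    using x_less_z by (intro multiplicity_geI) auto
  then have "multiplicity 2 x \<le> multiplicity 2 (z - x)" using j by simp
  then obtain w s d' e' where w: "w > 0" "int s = int (multiplicity 2 (z - x)) - int (multiplicity 2 x)"
    "u2 = w ^ 2 ^ s" "w ^ e' = n ^ d'" "odd e'" "odd d'" by (rule exists_w)
  have "s > 0" using w(2) mzx j by simp
  then obtain s' where s': "s = Suc s'" using gr0_implies_Suc by blast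
  have u2: "u2 = (w ^ 2 ^ s')\<^sup>2" by (simp add: w(3) s' power_mult[symmetric] mult.commute)
  note sq = u2_square_consequences[OF u2]
  have u1_4: "u1 mod 4 = 1"
  proof -
    have "u1 mod 8 = 5" using sq(1) by (simp add: cong_def)
    then show ?thesis by presburger
  qed

  define A B where "A = c ^ z'" and "B = u1 ^ x'"
  have oddAB: "odd A" "odd B" using odd_c odd_u1 by (auto simp: A_def B_def)
  have "[A = c] (mod 8)" unfolding A_def by (rule odd_power_mod_8[OF odd_c z'(2)])
  then have A8: "A mod 8 = 5" using c_mod_8 by (simp add: cong_def)
  have "[B = u1] (mod 8)" unfolding B_def by (rule odd_power_mod_8[OF odd_u1 x'(2)])
  then have B8: "B mod 8 = 5" using sq(1) by (simp add: cong_def)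
  have AB: "A ^ 2 ^ Suc j - B ^ 2 ^ Suc j = (4 * u) ^ y * n ^ (y - z)"
  proof -
    have "A ^ 2 ^ Suc j = c ^ z" unfolding power_mult[symmetric] A_def z'(1) by (simp only: ac_simps)
    moreover have "B ^ 2 ^ Suc j = u1 ^ x" unfolding power_mult[symmetric] B_def x'(1) by (simp only: ac_simps)
    ultimately show ?thesis using eqn by simp
  qed
  \<comment> \<open>The difference of the powers has at least 2y factors 2, no fewer than j + 5, and
    the exponent 2^(j+1) accounts for only j + 1 of them.\<close>
  have "16 dvd A - B"
  proof -
    have "2 ^ (2 * y) dvd A ^ 2 ^ Suc j - B ^ 2 ^ Suc j"
      unfolding AB by (simp add: power_mult_distrib power_mult)
    moreover have "4 dvd A - B" using A8 B8 by presburger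
    ultimately have d: "2 ^ (2 * y) dvd (A - B) * int (2 ^ Suc j)"
      using oddAB by (intro two_power_dvd_power_diff) auto
    have "2 ^ Suc j dvd z" unfolding z'(1) by simp
    then have "2 ^ Suc j \<le> z" using x_less_z by (intro dvd_imp_le) auto
    moreover have "Suc j < 2 ^ Suc j" by (rule less_exp)
    ultimately have "4 + Suc j \<le> 2 * y" using z_less_y y_ge_3 by linarith
    then have "(2::int) ^ (4 + Suc j) dvd 2 ^ (2 * y)" by (rule le_imp_power_dvd)
    then have "2 ^ (4 + Suc j) dvd (A - B) * int (2 ^ Suc j)" using d dvd_trans by blast
    moreover have "(2::int) ^ (4 + Suc j) = 16 * int (2 ^ Suc j)" by (simp add: power_add)
    ultimately have "16 * int (2 ^ Suc j) dvd (A - B) * int (2 ^ Suc j)" by (simp only:)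
    then show ?thesis by (subst (asm) dvd_times_right_cancel_iff) simp_all
  qed
  then obtain t where t: "A - B = 16 * t" by blast
  \<comment> \<open>Half of A + B, written without division. As 16 divides A - B, h is congruent to
    A modulo 8, hence 5 and no square.\<close>
  define h where "h = A - 8 * t"
  have AB2: "A + B = 2 * h" using t by (simp add: h_def)
  have h8: "h mod 8 = 5" using A8 by (simp add: h_def) presburger
  then have oddh: "odd h" by presburger
  have "A > 0" "B > 0" using c_pos u1_pos by (auto simp: A_def B_def)
  then have h0: "h > 0" using AB2 by linarith
  have copAB: "coprime A B"
  proof -
    have "coprime c u1"
    proof (rule coprimeI)
      fix d assume d: "d dvd c" "d dvd u1"
      show "is_unit d"
      proof (rule ccontr)
        assume "\<not> is_unit d"
        moreover have "d \<noteq> 0" using d(1) c_pos by auto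
        ultimately obtain p where "prime p" "p dvd d" using prime_divisor_exists by blast
        then show False using prime_dvd_c(4)[of p] d dvd_trans by blast
      qed
    qed
    then show ?thesis by (simp add: A_def B_def)
  qed
  obtain Q where "A ^ 2 ^ Suc j - B ^ 2 ^ Suc j = h * (2 * Q)" "coprime h Q"
    using two_power_diff_coprime_cofactor[OF oddh copAB AB2] by blast
  then have Q: "h * (2 * Q) = (4 * u) ^ y * n ^ (y - z)" "coprime h (2 * Q)" using AB oddh by auto
  have "0 < (4 * u) ^ y * n ^ (y - z)" using u_ge_3 n_gt_1 by simp
  then have Q0: "2 * Q > 0" using h0 Q(1) by (metis zero_less_mult_pos)

  have not_square: "\<not> (\<exists>r. t = r\<^sup>2)" if "odd t" "t mod 8 \<noteq> 1" for t :: int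
  proof
    assume "\<exists>r. t = r\<^sup>2"
    then obtain r where "t = r\<^sup>2" by blast
    then have "[t = 1] (mod 8)" using odd_square_mod_8[of r] that(1) by simp
    then show False using that(2) by (simp add: cong_def)
  qed

  \<comment> \<open>For even y the product h * 2Q is a square, and so would be its coprime factor
    h.\<close>
  have y: "odd y"
  proof (rule ccontr)
    assume "\<not> odd y"
    then obtain k where k: "y = 2 * k" by blast
    obtain l where l: "z = 2 * l" using assms(2) by blast
    have "y - z = (k - l) * 2" by (simp add: k l algebra_simps)
    moreover have "(4 * u) ^ y = ((4 * u) ^ k)\<^sup>2" by (simp only: k power_mult[symmetric] mult.commute)
    ultimately have "h * (2 * Q) = ((4 * u) ^ k * n ^ (k - l))\<^sup>2"
      using Q(1) by (simp only: power_mult power_mult_distrib)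
    moreover have "(4 * u) ^ k * n ^ (k - l) > 0" using u_ge_3 n_gt_1 by simp
    ultimately obtain r where "h = r\<^sup>2" using nth_power_coprime_factors[OF Q(2) h0 Q0] by metis
    then show False using not_square[OF oddh] h8 by auto
  qed
  have yz: "odd (y - z)" using y assms(2) z_less_y by simp

  \<comment> \<open>If u divides h, coprimality of h with its cofactor puts all of u^y into h. Apart
    from this factor, recorded by i = 1, the odd number h divides n^(y-z).\<close>
  obtain h' R i where hR: "h = u ^ (i * y) * h'" "i = 0 \<or> i = (1::nat)" "n ^ (y - z) = h' * R"
    "R dvd 2 * Q"
  proof (cases "u dvd h")
    case True
    have "coprime u (2 * Q)"
      using Q(2) True by (meson coprime_common_divisor coprimeI dvd_trans)
    then have cop: "coprime (u ^ y) (2 * Q)" by simp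
    have "u ^ y dvd h * (2 * Q)" unfolding Q(1) by (simp add: power_mult_distrib)
    then have "u ^ y dvd h" using cop by (simp only: coprime_dvd_mult_left_iff)
    then obtain h' where h': "h = u ^ y * h'" by blast
    have "u ^ y * (h' * (2 * Q)) = u ^ y * (4 ^ y * n ^ (y - z))"
      using Q(1) unfolding h' power_mult_distrib by (simp only: ac_simps)
    then have eq: "h' * (2 * Q) = 4 ^ y * n ^ (y - z)" using u_ge_3 by simp
    have "coprime h' 2" using oddh h' by simp
    then have "coprime h' (2 ^ (2 * y))" by (simp only: coprime_power_right_iff) simp
    moreover have "(2::int) ^ (2 * y) = 4 ^ y" by (simp add: power_mult)
    then have "h' dvd 2 ^ (2 * y) * n ^ (y - z)" by (simp only: eq[symmetric] dvd_triv_left)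
    ultimately have "h' dvd n ^ (y - z)" by (simp only: coprime_dvd_mult_right_iff)
    then obtain R where R: "n ^ (y - z) = h' * R" by blast
    have "h' \<noteq> 0" using h' h0 by auto
    then have "2 * Q = 4 ^ y * R" using eq R by simp
    then show ?thesis using that[of 1 h' R] h' R by simp
  next
    case False
    have "coprime u h" using prime_u False by (simp add: prime_imp_coprime)
    moreover have "coprime h 2" using oddh by simp
    moreover have "(4::int) * u = 2 * (2 * u)" by simp
    ultimately have "coprime h ((4 * u) ^ y)"
      by (simp only: coprime_power_right_iff coprime_mult_right_iff coprime_commute) simp
    moreover have "h dvd (4 * u) ^ y * n ^ (y - z)" unfolding Q(1)[symmetric] by simp
    ultimately have "h dvd n ^ (y - z)" by (simp only: coprime_dvd_mult_right_iff)
    then obtain R where R: "n ^ (y - z) = h * R" by blast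
    have "2 * Q = (4 * u) ^ y * R" using Q(1) R h0 by simp
    then show ?thesis using that[of 0 h R] R by simp
  qed
  have h'0: "h' > 0" using h0 hR(1) u_ge_3 by (simp add: zero_less_mult_iff)
  have oddh': "odd h'" using oddh hR(1) by simp
  have R0: "R > 0" using hR(3) h'0 n_gt_1 by (metis zero_less_mult_pos zero_less_power zero_less_one order_less_trans)
  have h'h: "h' dvd h" using hR(1) by simp
  have coph'R: "coprime h' R" using Q(2) h'h hR(4) by (meson coprime_divisors)

  \<comment> \<open>A prime p of h' divides n, hence u2, so c = 8 (mod p). It also divides A + B, so
    A = -B, and the odd exponents z' and x' reduce this to (c/p) = (-u1/p).\<close>
  have "jacobi 2 h' = jacobi (-1 * u1) h'"
  proof (rule jacobi_transfer)
    fix p assume p: "prime p" "p dvd h'"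
    have q: "odd p" using p(2) oddh' dvd_trans by blast
    have "p dvd n ^ (y - z)" using p(2) hR(3) by simp
    then have "p dvd u2" using prime_dvd_n_iff[OF p(1)] prime_dvd_power[OF p(1)] by blast
    then have "p dvd u\<^sup>2 - 4" using u1_u2 by (metis dvd_mult)
    then have "[c = 2 ^ 3] (mod p)" by (simp add: c_def cong_iff_dvd_diff)
    then have c2: "Legendre c p = Legendre 2 p" 
      using Legendre_cong[of c "2 ^ 3" p] Legendre_power_odd[OF p(1) q, of 3 2] by simp
    have "p dvd A + B" using p(2) h'h AB2 dvd_trans by (metis dvd_mult)
    then have "[A = -1 * B] (mod p)" by (simp add: cong_iff_dvd_diff)
    then have "Legendre A p = Legendre (-1 * B) p" by (rule Legendre_cong)
    then have "Legendre c p = Legendre (-1) p * Legendre u1 p"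
      unfolding Legendre_mult[OF p(1) q] A_def B_def Legendre_power_odd[OF p(1) q z'(2)]
        Legendre_power_odd[OF p(1) q x'(2)] .
    then show "Legendre 2 p = Legendre (-1 * u1) p"
      using c2 Legendre_mult[OF p(1) q, of "-1" u1] by simp
  qed
  then have jac2: "jacobi 2 h' = jacobi (-1) h' * jacobi u1 h'"
    using jacobi_mult_left[OF oddh', of "-1" u1] by simp
  have cop_u1: "coprime u1 h'"
  proof (rule coprimeI)
    fix d assume d: "d dvd u1" "d dvd h'"
    show "is_unit d"
    proof (rule ccontr)
      assume "\<not> is_unit d"
      moreover have "d \<noteq> 0" using d(1) u1_pos by auto
      ultimately obtain p where p: "prime p" "p dvd d" using prime_divisor_exists by blast
      then have "p dvd h'" using d(2) dvd_trans by blast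
      then have "p dvd n ^ (y - z)" using hR(3) by simp
      then have "p dvd n" using prime_dvd_power[OF p(1)] by blast
      then show False using prime_dvd_u1(6)[of p] p d(1) dvd_trans by blast
    qed
  qed
  have rec1: "jacobi u1 h' = jacobi h' u1"
    using jacobi_reciprocity[OF u1_pos h'0 odd_u1 oddh' cop_u1] u1_4 by simp
  \<comment> \<open>At a prime of u1 the term B vanishes, so 2h is an odd power of c, whose symbol
    is (2/p).\<close>
  have jh: "jacobi h u1 = 1"
  proof (rule jacobi_eq_1)
    fix p assume p: "prime p" "p dvd u1"
    note q = prime_dvd_u1[OF p]
    have "p dvd B" unfolding B_def using p(2) x'(2) by (metis dvd_power dvd_trans odd_pos)
    then have "[2 * h = A] (mod p)" unfolding AB2[symmetric] by (simp add: cong_iff_dvd_diff)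
    then have "Legendre 2 p * Legendre h p = Legendre A p"
      using Legendre_cong Legendre_mult[OF p(1) q(1)] by metis
    also have "\<dots> = Legendre 2 p" 
      using Legendre_power_odd[OF p(1) q(1) z'(2), of c] q(8) by (simp add: A_def)
    finally show "Legendre h p = 1" using Legendre_pm1[OF q(2)] by auto
  qed
  have cop_u: "coprime u u1"
  proof -
    have "\<not> u dvd u1" using prime_dvd_u1(3)[OF prime_u] by auto
    then show ?thesis using prime_u by (simp add: prime_imp_coprime)
  qed
  have u0: "u > 0" using u_ge_3 by simp
  have "jacobi u u1 = jacobi u1 u"
    using jacobi_reciprocity[OF u0 u1_pos odd_u odd_u1 cop_u] u1_4 by simp
  then have ju: "jacobi u u1 = (if u mod 4 = 1 then 1 else -1)"
    using jacobi_prime[OF prime_u, of u1] sq(2) Legendre_minus_1[OF prime_u odd_u] by simp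
  have "jacobi (u ^ (i * y)) u1 * jacobi h' u1 = 1"
    using jh jacobi_mult_left[OF odd_u1, of "u ^ (i * y)" h'] hR(1) by simp
  then have jh': "jacobi h' u1 = (if i = 1 then jacobi u u1 else 1)"
    using hR(2) ju y by (auto simp: jacobi_power_left[OF odd_u1] split: if_splits)
  note jacs = jac2[unfolded rec1 jh' ju jacobi_2[OF h'0 oddh'] jacobi_minus_1[OF h'0 oddh']]
  have "[u ^ y = u] (mod 8)" by (rule odd_power_mod_8[OF odd_u y])
  then have "[u ^ y * h' = u * h'] (mod 8)" by (rule cong_mult) simp
  then have uh8: "i = 1 \<Longrightarrow> ((u mod 8) * (h' mod 8)) mod 8 = 5" 
    using h8 hR(1) by (simp add: cong_def mod_mult_eq)
  have h'4: "h' mod 4 = (h' mod 8) mod 4" "u mod 4 = (u mod 8) mod 4" by presburger+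
  \<comment> \<open>Without u^y in h one has h' = h = 5 (mod 8), so (2/h') = -1, while (-1/h') and
    (h'/u1) are both 1.\<close>
  have i1: "i = 1"
  proof (rule ccontr)
    assume "i \<noteq> 1"
    then have "i = 0" using hR(2) by simp
    then have "h' mod 8 = 5" using hR(1) h8 by simp
    then show False using jacs \<open>i = 0\<close> h'4 by simp
  qed
  \<comment> \<open>Of the four pairs (u, h') modulo 8 with product 5, the pairs (1, 5) and (7, 3)
    violate the relation \<open>jacs\<close>.\<close>
  have u_h': "u mod 8 = 3 \<and> h' mod 8 = 7 \<or> u mod 8 = 5 \<and> h' mod 8 = 1"
    using odd_mod_8_cases[OF odd_u] odd_mod_8_cases[OF oddh'] uh8[OF i1] jacs i1 h'4
    by (elim disjE) simp_all
  then have u35: "[u = 3] (mod 8) \<or> [u = -3] (mod 8)" by (auto simp: cong_def)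
  \<comment> \<open>If w were a square, the odd exponents would make n a square, and then also h', a
    coprime factor of n^(y-z); but h' is 7 modulo 8 when u = 3 (mod 8).\<close>
  have nsq: "\<not> is_square w" if "[u = 3] (mod 8)"
  proof
    assume "is_square w"
    then obtain r where "w = r\<^sup>2" by (auto elim: is_nth_powerE)
    then have "n ^ d' = (r ^ e')\<^sup>2" using w(4) by (simp add: power_mult[symmetric] mult.commute)
    moreover have "n > 0" using n_gt_1 by simp
    ultimately obtain v where v: "v > 0" "n = v\<^sup>2" using odd_power_square_imp_square w(6) by metis
    have "h' * R = (v ^ (y - z))\<^sup>2" 
      unfolding hR(3)[symmetric] v(2) by (simp add: power_mult[symmetric] mult.commute)
    moreover have "v ^ (y - z) > 0" using v by simp
    ultimately obtain q where "h' = q\<^sup>2"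
      using nth_power_coprime_factors[OF coph'R h'0 R0] by metis
    moreover have "h' mod 8 = 7" using u_h' that by (auto simp: cong_def)
    ultimately show False using not_square[OF oddh'] by auto
  qed
  have wc: "Legendre w p = 1" if p: "prime p" "p dvd c" for p
    using Legendre_w[OF w(4-6) p(1) prime_dvd_c(1)[OF p]] Legendre_n_c_even(2)[OF assms p] by simp
  have "jacobi 2 w = 1"
    using jacobi_eq_1[of c w] wc jacobi_divisor_c[OF w(1) w_dvd[OF w(3)]] by simp
  moreover have "odd w" using odd_u2 w(3) by simp
  ultimately have "w mod 8 = 1 \<or> w mod 8 = 7" using jacobi_2[OF w(1)] by (auto split: if_splits)
  then have w8: "[w = 1] (mod 8) \<or> [w = -1] (mod 8)" by (auto simp: cong_def)
  have wu: "Legendre w p = Legendre u p" if p: "prime p" "p dvd u1" for p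
  proof -
    note q = prime_dvd_u1[OF p]
    have "Legendre ((4 * u) ^ y * n ^ (y - z)) p = Legendre (c ^ z) p" by (rule Legendre_cong[OF q(10)])
    then have "Legendre u p * Legendre n p = 1"
      using Legendre_power_odd[OF p(1) q(1) y, of "4 * u"] q(9) Legendre_power_odd[OF p(1) q(1) yz, of n]
        Legendre_power_even[OF p(1) q(1) assms(2) q(4)] 
        Legendre_mult[OF p(1) q(1), of "(4 * u) ^ y" "n ^ (y - z)"] by simp
    then show ?thesis using Legendre_w[OF w(4-6) p(1) q(1)] Legendre_pm1[OF q(3)] by auto
  qed
  show ?thesis
    by (intro conjI exI[of _ w] exI[of _ s] exI[of _ "Suc j"] allI impI)
      (use sq(1) w w8 j mxz y u35 wc wu nsq in \<open>simp_all add: c_def\<close>)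
qed

end

theorem theorem1p4:
  fixes u n u1 u2 :: int and x y z :: nat
  assumes "prime u" and "odd u"
    and "exceptional u x y z n"
    and "associated_decomposition u x y z n u1 u2"
  shows
    "(multiplicity 2 (u1 - 1) = 3 \<and>
      odd x \<and> multiplicity 2 y \<ge> 2 \<and> multiplicity 2 z = 1 \<and>
      (\<exists>t1 t2 :: int. t1 > 1 \<and> t2 > 1 \<and> coprime t1 t2 \<and> u1 = t1 * t2 \<and>
         [t1 = 5] (mod 8) \<and> [t2 = 5] (mod 8) \<and>
         t2 ^ x + t1 ^ x = 2 * (u\<^sup>2 + 4) ^ (z div 2) \<and>
         t2 ^ x - t1 ^ x = 2 ^ (y + 1) * u ^ (y div 2) * n ^ ((y - z) div 2)))
     \<or>
     ([u1 = 5] (mod 8) \<and>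
      (\<exists>(w :: int) (s :: nat). w > 0 \<and>
         int s = int (multiplicity 2 (z - x)) - int (multiplicity 2 x) \<and>
         u2 = w ^ (2 ^ s) \<and>
         ((([w = 3] (mod 8) \<or> [w = -3] (mod 8)) \<and>
           odd x \<and> odd z \<and> multiplicity 2 y \<ge> 1 \<and>
           [u = 1] (mod 4) \<and>
           (\<forall>p. prime p \<and> p dvd u\<^sup>2 + 4 \<longrightarrow> Legendre u1 p = Legendre w p) \<and>
           (\<forall>p. prime p \<and> p dvd u1 \<longrightarrow> Legendre w p = Legendre (u\<^sup>2 + 4) p))
          \<or>
          (([w = 1] (mod 8) \<or> [w = -1] (mod 8)) \<and>
           (\<exists>\<beta> \<ge> 1. multiplicity 2 x = \<beta> \<and> multiplicity 2 z = \<beta>) \<and> odd y \<and>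
           ([u = 3] (mod 8) \<or> [u = -3] (mod 8)) \<and>
           (\<forall>p. prime p \<and> p dvd u\<^sup>2 + 4 \<longrightarrow> Legendre w p = 1) \<and>
           (\<forall>p. prime p \<and> p dvd u1 \<longrightarrow> Legendre w p = Legendre u p) \<and>
           ([u = 3] (mod 8) \<longrightarrow> \<not> is_square w)))))"
proof -
  have "n > 1" "x > 0" using assms(3) by (auto simp: exceptional_def is_solution_def)
  then interpret exceptional_solution u n u1 u2 x y z
    using assms(1,2,4) exceptional_exponents_order[OF assms] 
    by unfold_locales (auto simp: associated_decomposition_def)
  show ?thesis
  proof (cases "odd z")
    case True
    have widen: "P \<and> (\<exists>w s. Q w s \<and> R w s \<and> S w s \<and> A w s) \<Longrightarrow>
        X \<or> P \<and> (\<exists>w s. Q w s \<and> R w s \<and> S w s \<and> (A w s \<or> B w s))"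
      for X P and Q R S A B :: "int \<Rightarrow> nat \<Rightarrow> bool" by blast
    show ?thesis using conclusion_z_odd[OF True] by (rule widen)
  next
    case z: False
    show ?thesis
    proof (cases "odd x")
      case True
      have "even z" using z by simp
      show ?thesis using conclusion_x_odd_z_even[OF True \<open>even z\<close>] by (rule disjI1)
    next
      case False
      then have "even x" "even z" using z by simp_all
      have widen: "P \<and> (\<exists>w s. Q w s \<and> R w s \<and> S w s \<and> B w s) \<Longrightarrow>
          X \<or> P \<and> (\<exists>w s. Q w s \<and> R w s \<and> S w s \<and> (A w s \<or> B w s))"
        for X P and Q R S A B :: "int \<Rightarrow> nat \<Rightarrow> bool" by blast
      show ?thesis using conclusion_x_z_even[OF \<open>even x\<close> \<open>even z\<close>] by (rule widen)
    qed
  qed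
qed
end
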